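(* Let $J$ be a bounded interval. For each $p$ with $1<p<\infty$ there exist a number $\lambda\in(0,1)$, a function $b\in\mathbf{BMO}^d$ on $J$, and a number $\varepsilon>0$ such that $|b_Ih_I|\le1-\varepsilon$ for all $I\in\mathcal{D}(J)$, the operator $(\mathrm{Id}-\pi_b)^{-1}$ exists and is a bounded operator on $L^p_o(J)$, but the operator $\mathrm{Id}-\lambda\pi_b$ is not invertible as an operator from $L^p_o(J)$ into $L^p_o(J)$.
   Context: Let $J$ be a bounded interval (e.g. $J=[0,1]$). $\mathcal{D}(J)$ denotes the family of dyadic subintervals of $J$, i.e. the intervals obtained from $J$ (including $J$ itself) by repeated bisection. For $I\in\mathcal{D}(J)$, $I_l$ and $I_r$ are its left and right halves, $|I|$ is its length, and $m_If=\frac1{|I|}\int_If$. The Haar function of $I$ is $h_I=|I|^{-1/2}(\chi_{I_r}-\chi_{I_l})$, and $\langle f,g\rangle=\int fg$. A (real-valued) locally integrable function $b$ on $J$ is in $\mathbf{BMO}^d$ (dyadic bounded mean oscillation) if there is a constant $C$ with $\int_K|b(x)-m_Kb|^2\,dx\le C|K|$ for all $K\in\mathcal{D}(J)$. Its Haar coefficients are $b_I=\langle b,h_I\rangle$. $L^p_o(J)=\{f\in L^p(J):\int_Jf=0\}$. The dyadic paraproduct associated to $b$ is the operator $$\pi_bf(x)=\sum_{I\in\mathcal{D}(J)}m_If\;b_I\,h_I(x),$$ which is bounded on $L^p(J)$ when $b\in\mathbf{BMO}^d$. $\mathrm{Id}$ denotes the identity operator. An operator is invertible on $L^p_o(J)$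 if it has a bounded inverse $L^p_o(J)\to L^p_o(J)$. *)

theory Defs
  imports "HOL-Analysis.Analysis"
begin

(* J is an arbitrary bounded interval (open, closed or half-open).  Bisection assigns the
   midpoint to the right half, so that the dyadic intervals of a given length partition J. *)

definition midpt :: "real set \<Rightarrow> real" where
  "midpt I = (Inf I + Sup I) / 2"

definition left_half :: "real set \<Rightarrow> real set" where
  "left_half I = {x \<in> I. x < midpt I}"

definition right_half :: "real set \<Rightarrow> real set" where
  "right_half I = {x \<in> I. midpt I \<le> x}"

fun dyadic_gen :: "real set \<Rightarrow> nat \<Rightarrow> real set set" where
  "dyadic_gen J 0 = {J}"
| "dyadic_gen J (Suc n) = (\<Union>I\<in>dyadic_gen J n. {left_half I, right_half I})"

definition dyadic :: "real set \<Rightarrow> real set set" where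
  "dyadic J = (\<Union>n. dyadic_gen J n)"

definition mean :: "real set \<Rightarrow> (real \<Rightarrow> real) \<Rightarrow> real" where
  "mean I f = (1 / measure lebesgue I) * (LINT x|lebesgue_on I. f x)"

definition haar :: "real set \<Rightarrow> real \<Rightarrow> real" where
  "haar I x = measure lebesgue I powr (-1/2) *
     (indicator (right_half I) x - indicator (left_half I) x)"

definition haar_coeff :: "real set \<Rightarrow> (real \<Rightarrow> real) \<Rightarrow> real set \<Rightarrow> real" where
  "haar_coeff J b I = (LINT x|lebesgue_on J. b x * haar I x)"

(* Since J itself is dyadic, the mean of b over J has to exist, so b is integrable on all of J. *)
definition BMO_d :: "real set \<Rightarrow> (real \<Rightarrow> real) set" where
  "BMO_d J = {b. integrable (lebesgue_on J) b \<and>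
     (\<exists>C. \<forall>K\<in>dyadic J.
        integrable (lebesgue_on K) (\<lambda>x. \<bar>b x - mean K b\<bar>\<^sup>2) \<and>
        (LINT x|lebesgue_on K. \<bar>b x - mean K b\<bar>\<^sup>2) \<le> C * measure lebesgue K)}"

(* The sum over all dyadic intervals is taken generation by generation.  At a given x only the
   decreasing chain of dyadic intervals containing x contributes.  For b in BMO_d and f in L^p,
   1 < p, the partial sums are the conditional expectations of the L^p-limit of the series, so
   the series converges almost everywhere and its pointwise sum is that L^p-limit. *)
definition paraproduct :: "real set \<Rightarrow> (real \<Rightarrow> real) \<Rightarrow> (real \<Rightarrow> real) \<Rightarrow> real \<Rightarrow> real" where
  "paraproduct J b f x =
     (\<Sum>n. \<Sum>I\<in>dyadic_gen J n. mean I f * haar_coeff J b I * haar I x)"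

(* Elements of L^p are represented by functions; only their values on J matter, and equality
   of elements is equality almost everywhere on J. *)

definition Lp :: "real set \<Rightarrow> real \<Rightarrow> (real \<Rightarrow> real) set" where
  "Lp J p = {f. f \<in> borel_measurable (lebesgue_on J) \<and>
                integrable (lebesgue_on J) (\<lambda>x. \<bar>f x\<bar> powr p)}"

definition Lp_norm :: "real set \<Rightarrow> real \<Rightarrow> (real \<Rightarrow> real) \<Rightarrow> real" where
  "Lp_norm J p f = (LINT x|lebesgue_on J. \<bar>f x\<bar> powr p) powr (1 / p)"

definition Lp_o :: "real set \<Rightarrow> real \<Rightarrow> (real \<Rightarrow> real) set" where
  "Lp_o J p = {f \<in> Lp J p. (LINT x|lebesgue_on J. f x) = 0}"

(* Linearity and boundedness force T to respect equality almost everywhere. *)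
definition bounded_op_Lp_o ::
  "real set \<Rightarrow> real \<Rightarrow> ((real \<Rightarrow> real) \<Rightarrow> real \<Rightarrow> real) \<Rightarrow> bool" where
  "bounded_op_Lp_o J p T \<longleftrightarrow>
     (\<forall>f\<in>Lp_o J p. T f \<in> Lp_o J p) \<and>
     (\<forall>f\<in>Lp_o J p. \<forall>g\<in>Lp_o J p.
        AE x in lebesgue_on J. T (\<lambda>y. f y + g y) x = T f x + T g x) \<and>
     (\<forall>c. \<forall>f\<in>Lp_o J p. AE x in lebesgue_on J. T (\<lambda>y. c * f y) x = c * T f x) \<and>
     (\<exists>C. \<forall>f\<in>Lp_o J p. Lp_norm J p (T f) \<le> C * Lp_norm J p f)"

definition invertible_Lp_o ::
  "real set \<Rightarrow> real \<Rightarrow> ((real \<Rightarrow> real) \<Rightarrow> real \<Rightarrow> real) \<Rightarrow> bool" where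
  "invertible_Lp_o J p T \<longleftrightarrow>
     bounded_op_Lp_o J p T \<and>
     (\<exists>S. bounded_op_Lp_o J p S \<and>
        (\<forall>f\<in>Lp_o J p. (AE x in lebesgue_on J. T (S f) x = f x) \<and>
                      (AE x in lebesgue_on J. S (T f) x = f x)))"

end

theory Submission
  imports Defs
begin

text \<open>
  The symbol lives on one nested chain of dyadic intervals: \<open>tail 0 = J\<close>, and \<open>tail (n + 1)\<close> is the
  right half of \<open>tail n\<close>.  The left halves \<open>ring n\<close> of the chain partition \<open>J\<close> up to its right end
  point.  The Haar term of the symbol is \<open>c n\<close> on \<open>tail (n + 1)\<close> and \<open>- c n\<close> on \<open>ring n\<close>, and it vanishes
  on every dyadic interval outside the chain.

  Write \<open>m n f\<close> for the mean of \<open>f\<close> over \<open>tail n\<close>.  The paraproduct \<open>\<pi> f\<close> is constant on each ring,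
  and its mean over \<open>tail n\<close> is the sum of \<open>c k * m k f\<close> over \<open>k < n\<close>.  Solving \<open>f - \<mu> * \<pi> f = g\<close>
  therefore amounts to solving the scalar recursion
    \<open>m (n + 1) f = (1 + \<mu> * c n) * m n f + (m (n + 1) g - m n g)\<close>
  and then correcting \<open>g\<close> by a function that is constant on the rings.  Both directions are controlled
  in the sequence space with norm \<open>\<Sum>n. \<bar>x n\<bar> powr p / 2 ^ n\<close>: a Hardy inequality
  (\<open>tail_mean_wlp\<close>, which uses \<open>p > 1\<close>) bounds the means of \<open>f\<close> by the norm of \<open>f\<close>, and conversely
  a sequence in this space is the sequence of means of an \<open>L\<^sup>p\<close> function that is constant on the rings
  (\<open>from_tail_means_Lp\<close>, \<open>tail_mean_from_tail_means\<close>).  So \<open>Id - \<mu> \<pi>\<close> is invertible as soon as the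
  recursion is bounded on that space (\<open>recursion_stable_imp_invertible\<close>), and it is not surjective
  if the recursion started by the jump \<open>0, 1, 1, \<dots>\<close> leaves the space (\<open>not_invertible\<close>).

  It remains to choose \<open>c\<close> so that the recursion is stable for \<open>\<mu> = 1\<close> and unstable for a smaller
  \<open>\<mu>\<close>.  Let \<open>c\<close> take the value \<open>a\<close> for \<open>j\<close> steps and then \<open>- a\<close> once, periodically.  Over one period
  the \<open>p\<close>-th power of a homogeneous solution, weighted by \<open>2\<^sup>-\<^sup>n\<close>, is multiplied by
    \<open>((1 + \<mu> * a) powr p / 2) ^ j * (1 - \<mu> * a) powr p / 2\<close>.
  Fix \<open>\<kappa> = \<mu> * a < 1\<close> with \<open>(1 + \<kappa>) powr p > 2\<close>; for large \<open>j\<close> this factor is at least \<open>1\<close>.  With that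
  \<open>j\<close> fixed, let \<open>a\<close> tend to \<open>1\<close>: at \<open>\<mu> = 1\<close> the last part \<open>(1 - a) powr p\<close> tends to \<open>0\<close> and the factor
  drops below \<open>1\<close>.  Then \<open>\<lambda> = \<kappa> / a\<close> and \<open>\<epsilon> = 1 - a\<close> have the required properties.
\<close>

section \<open>Inequalities for powers and for contracting sequences\<close>

text \<open>
  The coefficient of \<open>\<bar>x\<bar> powr p\<close> can be brought arbitrarily close to \<open>1\<close>.  In the recursions below it
  multiplies a contraction factor that it must not spoil.
\<close>
lemma abs_add_powr_le:
  fixes p \<delta> :: real
  assumes "0 < p" "0 < \<delta>"
  obtains C where "0 \<le> C"
    "\<And>x y::real. \<bar>x + y\<bar> powr p \<le> (1 + \<delta>) * \<bar>x\<bar> powr p + C * \<bar>y\<bar> powr p"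
proof -
  define \<eta> where "\<eta> = (1 + \<delta>) powr (1 / p) - 1"
  have \<eta>: "0 < \<eta>"
    using assms powr_less_mono2[of "1/p" 1 "1 + \<delta>"] by (simp add: \<eta>_def)
  have \<eta>p: "(1 + \<eta>) powr p = 1 + \<delta>"
    using assms by (simp add: \<eta>_def powr_powr)
  \<comment> \<open>Either \<open>y\<close> is small compared with \<open>x\<close> and is absorbed, or \<open>x\<close> is bounded by a multiple of \<open>y\<close>.\<close>
  have "\<bar>x + y\<bar> powr p \<le> (1 + \<delta>) * \<bar>x\<bar> powr p + (1 + 1 / \<eta>) powr p * \<bar>y\<bar> powr p"
    for x y :: real
  proof (cases "\<bar>y\<bar> \<le> \<eta> * \<bar>x\<bar>")
    case True
    then have "\<bar>x + y\<bar> \<le> (1 + \<eta>) * \<bar>x\<bar>"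
      by (simp add: algebra_simps)
    then have "\<bar>x + y\<bar> powr p \<le> ((1 + \<eta>) * \<bar>x\<bar>) powr p"
      using assms by (intro powr_mono2) auto
    also have "\<dots> = (1 + \<delta>) * \<bar>x\<bar> powr p"
      using \<eta> by (simp add: powr_mult \<eta>p)
    finally show ?thesis
      by (simp add: add_increasing2)
  next
    case False
    then have "\<bar>x\<bar> \<le> \<bar>y\<bar> / \<eta>"
      using \<eta> by (simp add: field_simps)
    then have "\<bar>x + y\<bar> \<le> (1 + 1 / \<eta>) * \<bar>y\<bar>"
      by (simp add: algebra_simps)
    then have "\<bar>x + y\<bar> powr p \<le> ((1 + 1 / \<eta>) * \<bar>y\<bar>) powr p"
      using assms by (intro powr_mono2) auto
    also have "\<dots> = (1 + 1 / \<eta>) powr p * \<bar>y\<bar> powr p"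
      using \<eta> by (simp add: powr_mult)
    finally show ?thesis
      using assms by (simp add: add_increasing)
  qed
  then show thesis
    using that[of "(1 + 1 / \<eta>) powr p"] by simp
qed

lemma abs_add_powr_le2:
  fixes p x y :: real
  assumes "0 < p"
  shows "\<bar>x + y\<bar> powr p \<le> 2 powr p * (\<bar>x\<bar> powr p + \<bar>y\<bar> powr p)"
proof -
  have "\<bar>x + y\<bar> powr p \<le> (2 * max \<bar>x\<bar> \<bar>y\<bar>) powr p"
    using assms by (intro powr_mono2) auto
  also have "\<dots> = 2 powr p * (max \<bar>x\<bar> \<bar>y\<bar>) powr p"
    by (simp add: powr_mult)
  also have "\<dots> \<le> 2 powr p * (\<bar>x\<bar> powr p + \<bar>y\<bar> powr p)"
    by (intro mult_left_mono) (auto simp: max_def)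
  finally show ?thesis .
qed

lemma summable_of_contraction:
  fixes y e :: "nat \<Rightarrow> real"
  assumes y: "\<And>n. 0 \<le> y n" and e: "\<And>n. 0 \<le> e n" "summable e"
    and q: "0 \<le> q" "q < 1" and step: "\<And>n. y (Suc n) \<le> q * y n + e n"
  shows "summable y" and "suminf y \<le> (y 0 + suminf e) / (1 - q)"
proof -
  have bound: "sum y {..<n} \<le> (y 0 + suminf e) / (1 - q)" for n
  proof -
    have "sum y {..<n} \<le> sum y {..<Suc n}"
      using y by simp
    also have "\<dots> = y 0 + (\<Sum>i<n. y (Suc i))"
      by (rule sum.lessThan_Suc_shift)
    also have "\<dots> \<le> y 0 + (\<Sum>i<n. q * y i + e i)"
      by (intro add_left_mono sum_mono step)
    also have "\<dots> = y 0 + q * sum y {..<n} + sum e {..<n}"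
      by (simp add: sum.distrib sum_distrib_left)
    also have "\<dots> \<le> y 0 + q * sum y {..<n} + suminf e"
      using sum_le_suminf[OF e(2), of "{..<n}"] e(1) by simp
    finally show ?thesis
      using q by (simp add: field_simps)
  qed
  show "summable y"
    using y bound by (rule summableI_nonneg_bounded)
  then show "suminf y \<le> (y 0 + suminf e) / (1 - q)"
    using bound by (intro suminf_le_const) auto
qed

text \<open>
  Here the contraction runs from \<open>n + 1\<close> to \<open>n\<close>, so the a priori bound \<open>B\<close> takes the place of the
  initial value: it closes the estimate of a partial sum at its upper end.
\<close>
lemma summable_of_backward_contraction:
  fixes y e :: "nat \<Rightarrow> real"
  assumes y: "\<And>n. 0 \<le> y n" "\<And>n. y n \<le> B" and e: "\<And>n. sum e {..<n} \<le> E"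
    and q: "0 \<le> q" "q < 1" and step: "\<And>n. y n \<le> q * y (Suc n) + e n"
  shows "summable y" and "suminf y \<le> (B + E) / (1 - q)"
proof -
  have bound: "sum y {..<n} \<le> (B + E) / (1 - q)" for n
  proof -
    have "sum y {..<n} \<le> (\<Sum>i<n. q * y (Suc i) + e i)"
      by (intro sum_mono step)
    also have "\<dots> = q * (\<Sum>i<n. y (Suc i)) + sum e {..<n}"
      by (simp add: sum.distrib sum_distrib_left)
    also have "\<dots> \<le> q * (sum y {..<n} + B) + E"
    proof (intro add_mono mult_left_mono e q)
      have "(\<Sum>i<n. y (Suc i)) \<le> y 0 + (\<Sum>i<n. y (Suc i))"
        using y by simp
      also have "\<dots> = sum y {..<Suc n}"
        by (rule sum.lessThan_Suc_shift[symmetric])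
      finally show "(\<Sum>i<n. y (Suc i)) \<le> sum y {..<n} + B"
        using y(2)[of n] by simp
    qed
    finally have "(1 - q) * sum y {..<n} \<le> q * B + E"
      by (simp add: algebra_simps)
    also have "\<dots> \<le> B + E"
      using q y[of 0] by (simp add: mult_left_le_one_le)
    finally show ?thesis
      using q by (simp add: field_simps)
  qed
  show "summable y"
    using y(1) bound by (rule summableI_nonneg_bounded)
  then show "suminf y \<le> (B + E) / (1 - q)"
    using bound by (intro suminf_le_const) auto
qed

lemma le_1_plus_powr: "1 \<le> p \<Longrightarrow> \<bar>x\<bar> \<le> 1 + \<bar>x\<bar> powr p" for x p :: real
proof (cases "\<bar>x\<bar> \<le> 1")
  case False
  assume "1 \<le> p"
  then have "\<bar>x\<bar> powr 1 \<le> \<bar>x\<bar> powr p"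
    using False by (intro powr_mono) auto
  then show ?thesis by simp
qed (simp add: add_increasing2)

section \<open>The sequence space with weights \<open>2\<^sup>-\<^sup>n\<close>\<close>

text \<open>
  The weight \<open>2\<^sup>-\<^sup>n\<close> is proportional to the length of \<open>ring n\<close>, so these are the \<open>L\<^sup>p\<close> functions that
  are constant on each ring.
\<close>
definition wlp :: "real \<Rightarrow> (nat \<Rightarrow> real) \<Rightarrow> bool" where
  "wlp p x \<longleftrightarrow> summable (\<lambda>n. \<bar>x n\<bar> powr p / 2 ^ n)"

definition wlp_sum :: "real \<Rightarrow> (nat \<Rightarrow> real) \<Rightarrow> real" where
  "wlp_sum p x = (\<Sum>n. \<bar>x n\<bar> powr p / 2 ^ n)"

lemma wlp_dominated:
  assumes "wlp p x" "\<And>n. \<bar>y n\<bar> powr p \<le> B * \<bar>x n\<bar> powr p"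
  shows "wlp p y" and "wlp_sum p y \<le> B * wlp_sum p x"
proof -
  have s: "summable (\<lambda>n. B * (\<bar>x n\<bar> powr p / 2 ^ n))"
    using assms(1) unfolding wlp_def by (rule summable_mult)
  have le: "\<bar>y n\<bar> powr p / 2 ^ n \<le> B * (\<bar>x n\<bar> powr p / 2 ^ n)" for n
    using assms(2)[of n] by (simp add: divide_right_mono)
  show "wlp p y"
    unfolding wlp_def using s
    by (rule summable_comparison_test'[where N = 0]) (use le in simp)
  then have "wlp_sum p y \<le> (\<Sum>n. B * (\<bar>x n\<bar> powr p / 2 ^ n))"
    unfolding wlp_def wlp_sum_def using s by (intro suminf_le le)
  also have "\<dots> = B * wlp_sum p x"
    using assms(1) unfolding wlp_def wlp_sum_def by (rule suminf_mult)
  finally show "wlp_sum p y \<le> B * wlp_sum p x" .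
qed

lemma wlp_mult:
  assumes "0 \<le> p" "wlp p x" "\<And>n. \<bar>c n\<bar> \<le> B"
  shows "wlp p (\<lambda>n. c n * x n)" and "wlp_sum p (\<lambda>n. c n * x n) \<le> B powr p * wlp_sum p x"
proof -
  have "\<bar>c n * x n\<bar> powr p \<le> B powr p * \<bar>x n\<bar> powr p" for n
    using assms(1) assms(3)[of n]
    by (auto simp: abs_mult powr_mult intro!: mult_right_mono powr_mono2)
  then show "wlp p (\<lambda>n. c n * x n)" "wlp_sum p (\<lambda>n. c n * x n) \<le> B powr p * wlp_sum p x"
    using wlp_dominated[OF assms(2), of "\<lambda>n. c n * x n" "B powr p"] by auto
qed

lemma wlp_add:
  assumes "0 < p" "wlp p x" "wlp p y"
  shows "wlp p (\<lambda>n. x n + y n)"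
    and "wlp_sum p (\<lambda>n. x n + y n) \<le> 2 powr p * (wlp_sum p x + wlp_sum p y)"
proof -
  have s: "summable (\<lambda>n. 2 powr p * (\<bar>x n\<bar> powr p / 2 ^ n + \<bar>y n\<bar> powr p / 2 ^ n))"
    using assms unfolding wlp_def by (intro summable_mult summable_add)
  have le: "\<bar>x n + y n\<bar> powr p / 2 ^ n
      \<le> 2 powr p * (\<bar>x n\<bar> powr p / 2 ^ n + \<bar>y n\<bar> powr p / 2 ^ n)" for n
    using divide_right_mono[OF abs_add_powr_le2[OF assms(1), of "x n" "y n"], of "2 ^ n"]
    by (simp add: field_simps)
  show *: "wlp p (\<lambda>n. x n + y n)"
    unfolding wlp_def using s
    by (rule summable_comparison_test'[where N = 0]) (use le in simp)
  have "wlp_sum p (\<lambda>n. x n + y n)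
      \<le> (\<Sum>n. 2 powr p * (\<bar>x n\<bar> powr p / 2 ^ n + \<bar>y n\<bar> powr p / 2 ^ n))"
    unfolding wlp_sum_def using * s by (intro suminf_le le) (auto simp: wlp_def)
  also have "\<dots> = 2 powr p * (wlp_sum p x + wlp_sum p y)"
    using assms unfolding wlp_sum_def wlp_def
    by (subst suminf_mult, intro summable_add, simp_all add: suminf_add)
  finally show "wlp_sum p (\<lambda>n. x n + y n) \<le> 2 powr p * (wlp_sum p x + wlp_sum p y)" .
qed

lemma wlp_bounded:
  assumes "0 \<le> p" "\<And>n. \<bar>c n\<bar> \<le> B"
  shows "wlp p c"
proof -
  have "wlp p (\<lambda>_. 1)"
    using summable_geometric[of "1/2::real"] by (simp add: wlp_def power_one_over)
  then show ?thesis
    using wlp_mult(1)[OF assms(1) _ assms(2), of "\<lambda>_. 1"] by simp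
qed

lemma wlp_shift:
  assumes "wlp p x"
  shows "wlp p (\<lambda>n. x (Suc n))" and "wlp_sum p (\<lambda>n. x (Suc n)) \<le> 2 * wlp_sum p x"
proof -
  have eq: "\<bar>x (Suc n)\<bar> powr p / 2 ^ n = 2 * (\<bar>x (Suc n)\<bar> powr p / 2 ^ Suc n)" for n
    by simp
  have s: "summable (\<lambda>n. \<bar>x (Suc n)\<bar> powr p / 2 ^ Suc n)"
    using assms unfolding wlp_def by (subst summable_Suc_iff)
  show "wlp p (\<lambda>n. x (Suc n))"
    unfolding wlp_def eq by (rule summable_mult[OF s])
  have "wlp_sum p (\<lambda>n. x (Suc n)) = 2 * (\<Sum>n. \<bar>x (Suc n)\<bar> powr p / 2 ^ Suc n)"
    unfolding wlp_sum_def eq by (rule suminf_mult[OF s])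
  also have "\<dots> \<le> 2 * wlp_sum p x"
    using suminf_split_head[of "\<lambda>n. \<bar>x n\<bar> powr p / 2 ^ n"] assms
    by (simp add: wlp_sum_def wlp_def)
  finally show "wlp_sum p (\<lambda>n. x (Suc n)) \<le> 2 * wlp_sum p x" .
qed

lemma wlp_abs_summable:
  assumes "1 \<le> p" "wlp p x"
  shows "summable (\<lambda>n. \<bar>x n\<bar> / 2 ^ n)"
proof (rule summable_comparison_test'[where N = 0])
  show "summable (\<lambda>n. (1 / 2) ^ n + \<bar>x n\<bar> powr p / 2 ^ n)"
    using assms by (intro summable_add) (auto simp: wlp_def)
  fix n
  have "\<bar>x n\<bar> \<le> 1 + \<bar>x n\<bar> powr p"
    using assms(1) by (rule le_1_plus_powr)
  then show "norm (\<bar>x n\<bar> / 2 ^ n) \<le> (1 / 2) ^ n + \<bar>x n\<bar> powr p / 2 ^ n"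
    by (simp add: power_one_over add_divide_distrib[symmetric] divide_right_mono)
qed

text \<open>
  Summation is bounded on this space, in contrast to the unweighted case, because the weight halves
  from one index to the next.
\<close>
lemma wlp_partial_sums:
  assumes "0 < p"
  obtains C where "0 \<le> C"
    "\<And>x. wlp p x \<Longrightarrow> wlp p (\<lambda>n. \<Sum>k<n. x k)"
    "\<And>x. wlp p x \<Longrightarrow> wlp_sum p (\<lambda>n. \<Sum>k<n. x k) \<le> C * wlp_sum p x"
proof -
  obtain C where C: "0 \<le> C"
    "\<And>x y::real. \<bar>x + y\<bar> powr p \<le> (1 + 1/2) * \<bar>x\<bar> powr p + C * \<bar>y\<bar> powr p"
    using abs_add_powr_le[OF assms, of "1/2"] by auto
  have *: "wlp p (\<lambda>n. \<Sum>k<n. x k) \<and> wlp_sum p (\<lambda>n. \<Sum>k<n. x k) \<le> 2 * C * wlp_sum p x"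
    if x: "wlp p x" for x
  proof -
    let ?y = "\<lambda>n. \<bar>\<Sum>k<n. x k\<bar> powr p / 2 ^ n" and ?e = "\<lambda>n. C / 2 * (\<bar>x n\<bar> powr p / 2 ^ n)"
    have e: "summable ?e" "suminf ?e = C / 2 * wlp_sum p x"
      using x unfolding wlp_def wlp_sum_def by (rule summable_mult, rule suminf_mult)
    have step: "?y (Suc n) \<le> 3 / 4 * ?y n + ?e n" for n
      using divide_right_mono[OF C(2)[of "\<Sum>k<n. x k" "x n"], of "2 ^ Suc n"]
      by (simp add: field_simps)
    have "summable ?y" "suminf ?y \<le> (?y 0 + suminf ?e) / (1 - 3 / 4)"
      by (rule summable_of_contraction[OF _ _ e(1) _ _ step]; use C(1) in simp)+
    then show ?thesis
      unfolding e(2) by (simp add: wlp_def wlp_sum_def)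
  qed
  show thesis
    using that[of "2 * C"] C(1) * by auto
qed

lemma wlp_partial_sums_bounded:
  assumes "0 < p" "\<And>n. \<bar>c n\<bar> \<le> B"
  shows "wlp p (\<lambda>n. \<Sum>k<n. c k)"
  using wlp_partial_sums[OF assms(1)] wlp_bounded[of p c B] assms by (metis less_imp_le)

section \<open>The recursion for the means\<close>

text \<open>
  With \<open>d\<close> the means of \<open>g\<close> over the chain, this computes the means of the solution \<open>f\<close> of
  \<open>f - \<pi> f = g\<close>.
\<close>
primrec mean_recursion :: "(nat \<Rightarrow> real) \<Rightarrow> (nat \<Rightarrow> real) \<Rightarrow> nat \<Rightarrow> real" where
  "mean_recursion c d 0 = d 0"
| "mean_recursion c d (Suc n) = (1 + c n) * mean_recursion c d n + (d (Suc n) - d n)"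

lemma mean_recursion_eq_add_sum: "mean_recursion c d n = d n + (\<Sum>k<n. c k * mean_recursion c d k)"
  by (induction n) (auto simp: algebra_simps)

lemma mean_recursion_unique:
  assumes "\<And>n. M n = d n + (\<Sum>k<n. c k * M k)"
  shows "mean_recursion c d n = M n"
proof (induction n)
  case (Suc n)
  then show ?case
    using assms[of n] assms[of "Suc n"] by (simp add: algebra_simps)
qed (use assms[of 0] in simp)

lemma mean_recursion_add: "mean_recursion c (\<lambda>n. d n + e n) n = mean_recursion c d n + mean_recursion c e n"
  by (induction n) (auto simp: algebra_simps)

lemma mean_recursion_scale: "mean_recursion c (\<lambda>n. t * d n) n = t * mean_recursion c d n"
  by (induction n) (auto simp: algebra_simps)

text \<open>
  One period is \<open>j\<close> times \<open>a\<close> followed by one \<open>- a\<close>; the dip is at the end of the period, so it occurs at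
  \<open>n mod (j + 1) = j\<close>.
\<close>
definition periodic_dip :: "real \<Rightarrow> nat \<Rightarrow> nat \<Rightarrow> real" where
  "periodic_dip a j n = (if Suc j dvd Suc n then - a else a)"

lemma abs_periodic_dip: "\<bar>periodic_dip a j n\<bar> = \<bar>a\<bar>"
  by (simp add: periodic_dip_def)

lemma periodic_dip_cases:
  obtains (dip) "n mod Suc j = j" "Suc n mod Suc j = 0" "periodic_dip a j n = - a"
  | (rise) "Suc n mod Suc j = Suc (n mod Suc j)" "periodic_dip a j n = a"
proof (cases "Suc j dvd Suc n")
  case True
  then have "Suc n mod Suc j = 0" by (simp add: dvd_eq_mod_eq_0)
  moreover from this have "n mod Suc j = j"
    by (auto simp: mod_Suc split: if_splits)
  ultimately show thesis
    using True dip by (simp add: periodic_dip_def)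
next
  case False
  then have "Suc n mod Suc j \<noteq> 0" by (simp add: dvd_eq_mod_eq_0)
  then have "Suc n mod Suc j = Suc (n mod Suc j)"
    by (auto simp: mod_Suc split: if_splits)
  then show thesis
    using False rise by (simp add: periodic_dip_def)
qed

definition recursion_stable :: "real \<Rightarrow> (nat \<Rightarrow> real) \<Rightarrow> bool" where
  "recursion_stable p c \<longleftrightarrow> (\<exists>C\<ge>0. \<forall>d. wlp p d \<longrightarrow>
     wlp p (mean_recursion c d) \<and> wlp_sum p (mean_recursion c d) \<le> C * wlp_sum p d)"

text \<open>
  The single step can expand; only the whole period contracts.  A periodic weight \<open>v\<close> spreads the
  small factor of the dip over the period, after which each single step contracts by \<open>1/2\<close>.
\<close>
lemma periodic_dip_stable:
  assumes p: "0 < p" and a: "0 \<le> a" "a \<le> 1"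
    and dip: "(1 - a) powr p * (2 * 2 powr p) ^ j \<le> 1 / 2"
  shows "recursion_stable p (periodic_dip a j)"
proof -
  let ?c = "periodic_dip a j"
  define Q where "Q = 2 * 2 powr p"
  have Q: "1 < Q"
    using p ge_one_powr_ge_zero[of 2 p] by (simp add: Q_def)
  define v where "v n = 1 / Q ^ (n mod Suc j)" for n
  have v: "0 < v n" "v n \<le> 1" "1 / Q ^ j \<le> v n" for n
  proof -
    show "0 < v n" "v n \<le> 1"
      using Q by (auto simp: v_def)
    have "n mod Suc j \<le> j"
      using mod_less_divisor[of "Suc j" n] by linarith
    then show "1 / Q ^ j \<le> v n"
      using Q by (auto simp: v_def intro!: divide_left_mono power_increasing)
  qed
  have v_step: "v (Suc n) * (1 + ?c n) powr p \<le> v n / 2" for n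
  proof (cases rule: periodic_dip_cases[where n = n and j = j and a = a])
    case dip
    then show ?thesis
      using assms(4) Q by (simp add: v_def Q_def[symmetric] field_simps)
  next
    case rise
    have "(1 + a) powr p \<le> Q / 2"
      using a p by (auto simp: Q_def intro!: powr_mono2)
    then show ?thesis
      using rise Q by (simp add: v_def field_simps)
  qed
  \<comment> \<open>The lost factor \<open>1 + 1\<close> is compensated by the factor \<open>1/2\<close> between \<open>2\<^sup>-\<^sup>n\<close> and its successor.\<close>
  obtain C where C: "0 \<le> C"
    "\<And>x y::real. \<bar>x + y\<bar> powr p \<le> (1 + 1) * \<bar>x\<bar> powr p + C * \<bar>y\<bar> powr p"
    using abs_add_powr_le[OF p, of 1] by auto
  have main: "wlp p (mean_recursion ?c d) \<and>
      wlp_sum p (mean_recursion ?c d) \<le> Q ^ j * (2 * (1 + C * (2 powr p * 3))) * wlp_sum p d"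
    if d: "wlp p d" for d
  proof -
    let ?M = "mean_recursion ?c d"
    let ?D = "\<lambda>n. d (Suc n) + - d n"
    have nd: "wlp p (\<lambda>n. - d n)" "wlp_sum p (\<lambda>n. - d n) = wlp_sum p d"
      using d by (auto simp: wlp_def wlp_sum_def)
    have D: "wlp p ?D" "wlp_sum p ?D \<le> 2 powr p * 3 * wlp_sum p d"
    proof -
      show "wlp p ?D" using wlp_add(1)[OF p wlp_shift(1)[OF d] nd(1)] .
      have "wlp_sum p ?D \<le> 2 powr p * (wlp_sum p (\<lambda>n. d (Suc n)) + wlp_sum p d)"
        using wlp_add(2)[OF p wlp_shift(1)[OF d] nd(1)] nd(2) by simp
      also have "\<dots> \<le> 2 powr p * (2 * wlp_sum p d + wlp_sum p d)"
        using wlp_shift(2)[OF d] by (intro mult_left_mono add_right_mono) auto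
      finally show "wlp_sum p ?D \<le> 2 powr p * 3 * wlp_sum p d" by simp
    qed
    let ?y = "\<lambda>n. v n * (\<bar>?M n\<bar> powr p / 2 ^ n)" and ?e = "\<lambda>n. C * (\<bar>?D n\<bar> powr p / 2 ^ n)"
    have e: "summable ?e" "suminf ?e = C * wlp_sum p ?D"
      using D(1) unfolding wlp_def wlp_sum_def by (rule summable_mult, rule suminf_mult)
    have step: "?y (Suc n) \<le> 1 / 2 * ?y n + ?e n" for n
    proof -
      have c1: "0 \<le> 1 + ?c n"
        using a by (auto simp: periodic_dip_def)
      have "\<bar>?M (Suc n)\<bar> powr p \<le> 2 * ((1 + ?c n) powr p * \<bar>?M n\<bar> powr p) + C * \<bar>?D n\<bar> powr p"
        using C(2)[of "(1 + ?c n) * ?M n" "?D n"] c1 by (simp add: abs_mult powr_mult)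
      then have "v (Suc n) * \<bar>?M (Suc n)\<bar> powr p
          \<le> v (Suc n) * (2 * ((1 + ?c n) powr p * \<bar>?M n\<bar> powr p) + C * \<bar>?D n\<bar> powr p)"
        using v[of "Suc n"] by (intro mult_left_mono) auto
      also have "\<dots> = 2 * (v (Suc n) * (1 + ?c n) powr p) * \<bar>?M n\<bar> powr p
          + v (Suc n) * (C * \<bar>?D n\<bar> powr p)"
        by (simp add: algebra_simps)
      also have "\<dots> \<le> 2 * (v n / 2) * \<bar>?M n\<bar> powr p + 1 * (C * \<bar>?D n\<bar> powr p)"
        using v_step[of n] v[of "Suc n"] C(1)
        by (intro add_mono mult_right_mono mult_left_mono) auto
      finally have "v (Suc n) * \<bar>?M (Suc n)\<bar> powr p / 2 ^ Suc n
          \<le> (v n * \<bar>?M n\<bar> powr p + C * \<bar>?D n\<bar> powr p) / 2 ^ Suc n"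
        by (intro divide_right_mono) auto
      also have "\<dots> \<le> 1 / 2 * ?y n + ?e n"
        using C(1) by (simp add: add_divide_distrib divide_left_mono)
      finally show ?thesis by simp
    qed
    have y: "summable ?y" "suminf ?y \<le> (?y 0 + suminf ?e) / (1 - 1 / 2)"
      by (rule summable_of_contraction[OF _ _ e(1) _ _ step]; use C(1) v in \<open>auto simp: less_imp_le\<close>)+
    have le: "\<bar>?M n\<bar> powr p / 2 ^ n \<le> Q ^ j * ?y n" for n
    proof -
      have "1 \<le> Q ^ j * v n"
        using v(3)[of n] Q by (simp add: field_simps)
      then have "1 * (\<bar>?M n\<bar> powr p / 2 ^ n) \<le> (Q ^ j * v n) * (\<bar>?M n\<bar> powr p / 2 ^ n)"
        by (intro mult_right_mono) auto
      then show ?thesis by (simp add: mult.assoc)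
    qed
    have sQ: "summable (\<lambda>n. Q ^ j * ?y n)"
      by (rule summable_mult[OF y(1)])
    have M: "wlp p ?M"
      unfolding wlp_def using sQ
      by (rule summable_comparison_test'[where N = 0]) (use le in simp)
    have "wlp_sum p ?M \<le> (\<Sum>n. Q ^ j * ?y n)"
      unfolding wlp_sum_def using M sQ by (intro suminf_le le) (auto simp: wlp_def)
    also have "\<dots> = Q ^ j * suminf ?y"
      by (rule suminf_mult[OF y(1)])
    also have "\<dots> \<le> Q ^ j * (2 * (wlp_sum p d + C * (2 powr p * 3 * wlp_sum p d)))"
    proof (intro mult_left_mono)
      have "?y 0 \<le> wlp_sum p d"
        using sum_le_suminf[of "\<lambda>n. \<bar>d n\<bar> powr p / 2 ^ n" "{0}"] d
        by (simp add: wlp_def wlp_sum_def v_def)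
      moreover have "C * wlp_sum p ?D \<le> C * (2 powr p * 3 * wlp_sum p d)"
        using D(2) C(1) by (rule mult_left_mono)
      ultimately show "suminf ?y \<le> 2 * (wlp_sum p d + C * (2 powr p * 3 * wlp_sum p d))"
        using y(2) e(2) by simp
    qed (use Q in simp)
    also have "\<dots> = Q ^ j * (2 * (1 + C * (2 powr p * 3))) * wlp_sum p d"
      by (simp add: algebra_simps)
    finally show ?thesis using M by simp
  qed
  show ?thesis
    unfolding recursion_stable_def
    by (rule exI[of _ "Q ^ j * (2 * (1 + C * (2 powr p * 3)))"]) (use main Q C(1) in auto)
qed

text \<open>
  The same device with the opposite inequality: a periodic weight turns growth over a period into
  monotonicity at each step, so the terms of the series do not tend to \<open>0\<close>.
\<close>
lemma periodic_dip_unstable: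
  assumes p: "0 < p" and \<kappa>: "0 \<le> \<kappa>" "\<kappa> < 1" and rise: "2 \<le> (1 + \<kappa>) powr p"
    and dip: "2 \<le> (1 - \<kappa>) powr p * ((1 + \<kappa>) powr p / 2) ^ j"
    and d: "d 0 = 0" "\<And>n. d (Suc n) = 1"
  shows "\<not> wlp p (mean_recursion (periodic_dip \<kappa> j) d)"
proof
  let ?c = "periodic_dip \<kappa> j" 
  let ?M = "mean_recursion ?c d"
  assume "wlp p ?M"
  then have lim: "(\<lambda>n. \<bar>?M n\<bar> powr p / 2 ^ n) \<longlonglongrightarrow> 0"
    unfolding wlp_def by (rule summable_LIMSEQ_zero)
  define r where "r = (1 + \<kappa>) powr p / 2"
  have r: "1 \<le> r" using rise by (simp add: r_def)
  define v where "v n = 1 / r ^ (n mod Suc j)" for n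
  have v: "0 < v n" "v n \<le> 1" for n
    using r by (auto simp: v_def)
  have v_step: "2 * v n \<le> v (Suc n) * (1 + ?c n) powr p" for n
  proof (cases rule: periodic_dip_cases[where n = n and j = j and a = \<kappa>])
    case dip
    then show ?thesis
      using assms(5) r by (simp add: v_def r_def[symmetric] field_simps)
  next
    case rise
    have "(1 + \<kappa>) powr p = 2 * r" by (simp add: r_def)
    then show ?thesis
      using rise r by (simp add: v_def field_simps)
  qed
  let ?y = "\<lambda>n. v n * (\<bar>?M n\<bar> powr p / 2 ^ n)"
  have step: "?y (Suc n) \<le> ?y (Suc (Suc n))" for n
  proof -
    have c1: "0 \<le> 1 + ?c (Suc n)"
      using \<kappa> by (auto simp: periodic_dip_def)
    have "\<bar>?M (Suc (Suc n))\<bar> powr p = (1 + ?c (Suc n)) powr p * \<bar>?M (Suc n)\<bar> powr p"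
      using c1 d(2) by (simp add: abs_mult powr_mult del: mean_recursion.simps(2) add: mean_recursion.simps(2)[of _ _ "Suc n"])
    then have "?y (Suc (Suc n)) = (v (Suc (Suc n)) * (1 + ?c (Suc n)) powr p) * \<bar>?M (Suc n)\<bar> powr p / 2 ^ Suc (Suc n)"
      by (simp add: mult_ac)
    also have "\<dots> \<ge> (2 * v (Suc n)) * \<bar>?M (Suc n)\<bar> powr p / 2 ^ Suc (Suc n)"
      using v_step[of "Suc n"] by (intro divide_right_mono mult_right_mono) auto
    finally show ?thesis by simp
  qed
  have "?y (Suc 0) \<le> ?y (Suc n)" for n
  proof (induction n)
    case (Suc n)
    then show ?case using step[of n] by (rule order_trans)
  qed simp
  moreover have "?y n \<le> \<bar>?M n\<bar> powr p / 2 ^ n" for n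
    using v[of n] by (intro mult_left_le_one_le) auto
  ultimately have "?y (Suc 0) \<le> \<bar>?M (Suc n)\<bar> powr p / 2 ^ Suc n" for n
    by (meson order_trans)
  moreover have "(\<lambda>n. \<bar>?M (Suc n)\<bar> powr p / 2 ^ Suc n) \<longlonglongrightarrow> 0"
    using LIMSEQ_Suc[OF lim] .
  ultimately have "?y (Suc 0) \<le> 0"
    using LIMSEQ_le_const by blast
  moreover have "0 < ?y (Suc 0)"
    using v(1)[of "Suc 0"] d by simp
  ultimately show False by linarith
qed

text \<open>
  The order of choice matters: \<open>\<kappa>\<close> first, then \<open>j\<close> depending on \<open>\<kappa>\<close>, and last \<open>a\<close> close to \<open>1\<close>
  depending on \<open>j\<close>.
\<close>
lemma periodic_dip_parameters:
  fixes p :: real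
  assumes "1 < p"
  obtains \<kappa> a j where "0 < \<kappa>" "\<kappa> < a" "a < 1"
    "2 \<le> (1 + \<kappa>) powr p" "2 \<le> (1 - \<kappa>) powr p * ((1 + \<kappa>) powr p / 2) ^ j"
    "(1 - a) powr p * (2 * 2 powr p) ^ j \<le> 1 / 2"
proof -
  \<comment> \<open>The midpoint between \<open>2 powr (1 / p) - 1\<close>, where \<open>(1 + \<kappa>) powr p = 2\<close>, and \<open>1\<close>.\<close>
  define \<kappa> :: real where "\<kappa> = 2 powr (1 / p) / 2"
  have two: "2 powr (1 / p) < (2::real)"
    using assms powr_less_mono[of "1/p" 1 "2::real"] by simp
  have \<kappa>: "0 < \<kappa>" "\<kappa> < 1" "2 powr (1 / p) < 1 + \<kappa>"
    using two by (auto simp: \<kappa>_def)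
  have "(2 powr (1 / p)) powr p < (1 + \<kappa>) powr p"
    using \<kappa> assms by (intro powr_less_mono2) auto
  then have rise: "2 < (1 + \<kappa>) powr p"
    using assms by (simp add: powr_powr)
  obtain j where j: "2 / (1 - \<kappa>) powr p < ((1 + \<kappa>) powr p / 2) ^ j"
    using real_arch_pow[of "(1 + \<kappa>) powr p / 2"] rise by auto
  have "((\<lambda>a. (1 - a) powr p * (2 * 2 powr p) ^ j) \<longlongrightarrow> (1 - 1) powr p * (2 * 2 powr p) ^ j) (at_left (1::real))"
    using assms by (auto intro!: tendsto_eq_intros eventually_at_leftI[of 0])
  then have "eventually (\<lambda>a. (1 - a) powr p * (2 * 2 powr p) ^ j < 1 / 2) (at_left (1::real))"
    by (rule order_tendstoD) simp
  moreover have "eventually (\<lambda>a. \<kappa> < a \<and> a < 1) (at_left (1::real))"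
    using \<kappa> by (intro eventually_at_leftI[of \<kappa>]) auto
  ultimately obtain a where "(1 - a) powr p * (2 * 2 powr p) ^ j < 1 / 2" "\<kappa> < a" "a < 1"
    using eventually_happens[OF eventually_conj] trivial_limit_at_left_real by blast
  moreover have "2 \<le> (1 - \<kappa>) powr p * ((1 + \<kappa>) powr p / 2) ^ j"
    using j \<kappa> by (simp add: field_simps)
  ultimately show thesis
    using that \<kappa>(1) rise by (meson less_imp_le)
qed

section \<open>Integrals of powers\<close>

lemma Lp_add:
  assumes "0 < p" "f \<in> Lp J p" "g \<in> Lp J p"
  shows "(\<lambda>x. f x + g x) \<in> Lp J p"
    and "(LINT x|lebesgue_on J. \<bar>f x + g x\<bar> powr p)
      \<le> 2 powr p * ((LINT x|lebesgue_on J. \<bar>f x\<bar> powr p) + (LINT x|lebesgue_on J. \<bar>g x\<bar> powr p))"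
proof -
  have [measurable]: "f \<in> borel_measurable (lebesgue_on J)" "g \<in> borel_measurable (lebesgue_on J)"
    and i: "integrable (lebesgue_on J) (\<lambda>x. \<bar>f x\<bar> powr p)" "integrable (lebesgue_on J) (\<lambda>x. \<bar>g x\<bar> powr p)"
    using assms by (auto simp: Lp_def)
  have i2: "integrable (lebesgue_on J) (\<lambda>x. 2 powr p * (\<bar>f x\<bar> powr p + \<bar>g x\<bar> powr p))"
    using i by auto
  have i3: "integrable (lebesgue_on J) (\<lambda>x. \<bar>f x + g x\<bar> powr p)"
    using i2 by (rule Bochner_Integration.integrable_bound) (use abs_add_powr_le2[OF assms(1)] in auto)
  then show "(\<lambda>x. f x + g x) \<in> Lp J p"
    by (simp add: Lp_def)
  have "(LINT x|lebesgue_on J. \<bar>f x + g x\<bar> powr p)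
      \<le> (LINT x|lebesgue_on J. 2 powr p * (\<bar>f x\<bar> powr p + \<bar>g x\<bar> powr p))"
    using i3 i2 by (rule integral_mono) (rule abs_add_powr_le2[OF assms(1)])
  then show "(LINT x|lebesgue_on J. \<bar>f x + g x\<bar> powr p)
      \<le> 2 powr p * ((LINT x|lebesgue_on J. \<bar>f x\<bar> powr p) + (LINT x|lebesgue_on J. \<bar>g x\<bar> powr p))"
    using i by simp
qed

lemma Lp_scale:
  assumes "f \<in> Lp J p"
  shows "(\<lambda>x. t * f x) \<in> Lp J p"
  using assms by (auto simp: Lp_def abs_mult powr_mult)

text \<open>
  Jensen's inequality for \<open>\<bar>x\<bar> powr p\<close>, up to the constant \<open>2 powr p\<close>: the pointwise bound
  \<open>\<bar>y\<bar> \<le> t + t powr (1 - p) * \<bar>y\<bar> powr p\<close> is integrated and the level \<open>t\<close> optimised.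
\<close>
lemma powr_integral_le:
  fixes f :: "'a \<Rightarrow> real"
  assumes p: "1 < p" and A: "A \<in> sets M" "emeasure M A \<noteq> \<infinity>"
    and f: "integrable M f" "integrable M (\<lambda>x. \<bar>f x\<bar> powr p)"
  shows "\<bar>LINT x|M. indicator A x * f x\<bar> powr p
    \<le> 2 powr p * measure M A powr (p - 1) * (LINT x|M. indicator A x * \<bar>f x\<bar> powr p)"
proof -
  define X where "X = (LINT x|M. indicator A x * \<bar>f x\<bar> powr p)"
  define m where "m = measure M A"
  have X: "0 \<le> X" unfolding X_def by (intro integral_nonneg_AE) auto
  have m: "0 \<le> m" by (simp add: m_def)
  have iA: "integrable M (\<lambda>x. indicator A x * f x)" "integrable M (\<lambda>x. indicator A x * \<bar>f x\<bar> powr p)"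
    using integrable_mult_indicator[OF A(1) f(1)] integrable_mult_indicator[OF A(1) f(2)] by simp_all
  have i1: "integrable M (\<lambda>x. indicator A x * 1 :: real)"
    using A by (simp add: integrable_indicator_iff less_top)
  have bound: "\<bar>LINT x|M. indicator A x * f x\<bar> \<le> t * m + t powr (1 - p) * X" if t: "0 < t" for t
  proof -
    have pt: "\<bar>y\<bar> \<le> t + t powr (1 - p) * \<bar>y\<bar> powr p" for y
    proof -
      have "\<bar>y / t\<bar> \<le> 1 + \<bar>y / t\<bar> powr p"
        using p by (intro le_1_plus_powr) simp
      then have "t * \<bar>y / t\<bar> \<le> t * (1 + \<bar>y / t\<bar> powr p)"
        using t by (intro mult_left_mono) auto
      then show ?thesis
        using t by (simp add: abs_divide powr_divide powr_diff field_simps)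
    qed
    have "\<bar>LINT x|M. indicator A x * f x\<bar> \<le> (LINT x|M. \<bar>indicator A x * f x\<bar>)"
      by (rule integral_abs_bound)
    also have "\<dots> \<le> (LINT x|M. t * (indicator A x * 1) + t powr (1 - p) * (indicator A x * \<bar>f x\<bar> powr p))"
      using iA i1 by (intro integral_mono) (auto simp: indicator_def pt)
    also have "\<dots> = t * m + t powr (1 - p) * X"
      using iA i1 A by (simp add: X_def m_def)
    finally show ?thesis .
  qed
  have "\<bar>LINT x|M. indicator A x * f x\<bar> powr p \<le> 2 powr p * m powr (p - 1) * X"
  proof (cases "X = 0 \<or> m = 0")
    case False
    then have pos: "0 < X" "0 < m" using X m by auto
    \<comment> \<open>At this level the two terms of the bound agree.\<close>
    define t where "t = (X / m) powr (1 / p)"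
    have t: "0 < t" "t powr p = X / m"
      using pos p by (auto simp: t_def powr_powr)
    have "t powr (1 - p) * X = t * m"
      using t pos by (simp add: powr_diff field_simps)
    then have "\<bar>LINT x|M. indicator A x * f x\<bar> \<le> 2 * t * m"
      using bound[OF t(1)] by (simp add: mult.commute)
    then have "\<bar>LINT x|M. indicator A x * f x\<bar> powr p \<le> (2 * t * m) powr p"
      using p by (intro powr_mono2) auto
    also have "\<dots> = 2 powr p * (X / m) * m powr p"
      using t pos by (simp add: powr_mult)
    also have "\<dots> = 2 powr p * m powr (p - 1) * X"
      using pos by (simp add: powr_diff)
    finally show ?thesis .
  next
    case True
    have "\<bar>LINT x|M. indicator A x * f x\<bar> \<le> 0"
    proof (cases "m = 0")
      case True
      have lim: "((\<lambda>t. t powr (1 - p) * X) \<longlongrightarrow> 0) at_top"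
        using tendsto_mult_left_zero[OF tendsto_neg_powr[OF _ filterlim_ident], of "1 - p" X] p by simp
      show ?thesis
        by (rule tendsto_lowerbound[OF lim])
          (use bound True in \<open>auto intro: eventually_mono[OF eventually_gt_at_top[of 0]]\<close>)
    next
      case False
      then have "X = 0" using True by simp
      show ?thesis
      proof (rule field_le_epsilon)
        fix e :: real assume "0 < e"
        then show "\<bar>LINT x|M. indicator A x * f x\<bar> \<le> 0 + e"
          using bound[of "e / m"] False m \<open>X = 0\<close> by simp
      qed
    qed
    then show ?thesis using X p by simp
  qed
  then show ?thesis by (simp add: X_def m_def)
qed

section \<open>The chain of right halves\<close>

text \<open>
  Dyadic intervals can be open, closed or half-open.  Locating them between the open and the closed
  interval with the same end points covers all cases at once.
\<close>
lemma near_interval: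
  fixes u v :: real
  assumes "u < v" "{u<..<v} \<subseteq> I" "I \<subseteq> {u..v}"
  shows "I \<in> lmeasurable" "measure lebesgue I = v - u" "midpt I = (u + v) / 2"
proof -
  have I: "I = {u<..<v} \<union> (I \<inter> {u, v})"
    using assms by force
  have n: "I \<inter> {u, v} \<in> null_sets lebesgue"
    by (rule null_sets_completion_subset[of _ "{u, v}"])
      (auto intro!: finite_imp_null_set_lborel)
  have [measurable]: "I \<in> sets lebesgue"
    by (subst I) (use n in auto)
  show "measure lebesgue I = v - u"
    by (subst I, subst measure_Un_null_set) (use n assms(1) in auto)
  show "I \<in> lmeasurable"
    by (rule fmeasurableI2[of "{u..v}"]) (use assms in auto)
  have "I \<noteq> {}" using assms by force
  have "Inf I = u"
  proof (rule antisym)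
    have "Inf I \<le> Inf {u<..<v}"
      using assms by (intro cInf_superset_mono) (auto intro: bdd_below_mono[of "{u..v}"])
    then show "Inf I \<le> u" using assms by simp
    show "u \<le> Inf I" using \<open>I \<noteq> {}\<close> assms by (intro cInf_greatest) auto
  qed
  moreover have "Sup I = v"
  proof (rule antisym)
    have "Sup {u<..<v} \<le> Sup I"
      using assms by (intro cSup_subset_mono) (auto intro: bdd_above_mono[of "{u..v}"])
    then show "v \<le> Sup I" using assms by simp
    show "Sup I \<le> v" using \<open>I \<noteq> {}\<close> assms by (intro cSup_least) auto
  qed
  ultimately show "midpt I = (u + v) / 2" by (simp add: midpt_def)
qed

lemma near_interval_halves:
  fixes u v :: real
  assumes "u < v" "{u<..<v} \<subseteq> I" "I \<subseteq> {u..v}"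
  shows "{u<..<(u + v) / 2} \<subseteq> left_half I" "left_half I \<subseteq> {u..(u + v) / 2}"
    "{(u + v) / 2<..<v} \<subseteq> right_half I" "right_half I \<subseteq> {(u + v) / 2..v}"
  using assms by (force simp: left_half_def right_half_def near_interval(3)[OF assms])+

locale bounded_interval =
  fixes J :: "real set" and u v :: real
  assumes uv: "u < v" and J: "{u<..<v} \<subseteq> J" "J \<subseteq> {u..v}"
begin

text \<open>
  The left end point of the \<open>n\<close>-th interval of the chain.  At \<open>n = 0\<close> it is \<open>u\<close>, so \<open>tail 0\<close> is all of \<open>J\<close>.
\<close>
definition cutpoint :: "nat \<Rightarrow> real" where
  "cutpoint n = v - (v - u) / 2 ^ n"

definition tail :: "nat \<Rightarrow> real set" where
  "tail n = {x \<in> J. cutpoint n \<le> x}"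

definition ring :: "nat \<Rightarrow> real set" where
  "ring n = {x \<in> J. cutpoint n \<le> x \<and> x < cutpoint (Suc n)}"

lemma cutpoint_less: "cutpoint n < v"
  using uv by (simp add: cutpoint_def)

lemma cutpoint_Suc: "cutpoint (Suc n) = (cutpoint n + v) / 2"
  by (simp add: cutpoint_def field_simps)

lemma cutpoint_mono: "m \<le> n \<Longrightarrow> cutpoint m \<le> cutpoint n"
  using uv by (auto simp: cutpoint_def intro!: divide_left_mono)

lemma u_le_cutpoint: "u \<le> cutpoint n"
  using cutpoint_mono[of 0 n] by (simp add: cutpoint_def)

lemma tail_0: "tail 0 = J"
  using J by (auto simp: tail_def cutpoint_def)

lemma near_tail: "cutpoint n < v" "{cutpoint n<..<v} \<subseteq> tail n" "tail n \<subseteq> {cutpoint n..v}"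
  using J u_le_cutpoint[of n] cutpoint_less[of n] by (auto simp: tail_def) 

lemma near_ring: "cutpoint n < cutpoint (Suc n)" "{cutpoint n<..<cutpoint (Suc n)} \<subseteq> ring n" "ring n \<subseteq> {cutpoint n..cutpoint (Suc n)}"
proof -
  show "cutpoint n < cutpoint (Suc n)"
    using cutpoint_less[of n] by (simp add: cutpoint_Suc)
  show "{cutpoint n<..<cutpoint (Suc n)} \<subseteq> ring n"
  proof
    fix x assume x: "x \<in> {cutpoint n<..<cutpoint (Suc n)}"
    then have "x \<in> {u<..<v}"
      using u_le_cutpoint[of n] cutpoint_less[of "Suc n"] by simp
    then show "x \<in> ring n"
      using J(1) x by (auto simp: ring_def)
  qed
  show "ring n \<subseteq> {cutpoint n..cutpoint (Suc n)}"
    by (auto simp: ring_def)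
qed

lemma measure_tail: "tail n \<in> lmeasurable" "measure lebesgue (tail n) = (v - u) / 2 ^ n"
  using near_interval[OF near_tail[of n]] by (simp_all add: cutpoint_def)

lemma measure_ring: "ring n \<in> lmeasurable" "measure lebesgue (ring n) = (v - u) / 2 ^ Suc n"
proof -
  have "cutpoint (Suc n) - cutpoint n = (v - u) / 2 ^ Suc n"
    by (simp add: cutpoint_def field_simps)
  then show "ring n \<in> lmeasurable" "measure lebesgue (ring n) = (v - u) / 2 ^ Suc n"
    using near_interval[OF near_ring[of n]] by simp_all
qed

lemma J_lmeasurable: "J \<in> lmeasurable" and measure_J: "measure lebesgue J = v - u"
  using measure_tail[of 0] by (simp_all add: tail_0)

lemma J_sets [simp, measurable]: "J \<in> sets lebesgue"
  using J_lmeasurable by auto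

lemma right_half_tail: "right_half (tail n) = tail (Suc n)"
  using near_interval(3)[OF near_tail[of n]] cutpoint_mono[of n "Suc n"]
  by (auto simp: right_half_def tail_def cutpoint_Suc)

lemma left_half_tail: "left_half (tail n) = ring n"
  using near_interval(3)[OF near_tail[of n]]
  by (auto simp: left_half_def tail_def ring_def cutpoint_Suc)

lemma tail_Suc: "tail (Suc n) = tail n - ring n"
  using cutpoint_mono[of n "Suc n"] by (auto simp: tail_def ring_def)

lemma ring_subset_tail: "ring n \<subseteq> tail n"
  by (auto simp: tail_def ring_def)

lemma tail_subset: "tail n \<subseteq> J" and ring_subset: "ring n \<subseteq> J"
  by (auto simp: tail_def ring_def)

lemma sets_J: "A \<in> sets lebesgue \<Longrightarrow> A \<subseteq> J \<Longrightarrow> A \<in> sets (lebesgue_on J)"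
  by (simp add: sets_restrict_space_iff)

lemma tail_sets [measurable, simp]: "tail n \<in> sets (lebesgue_on J)"
  using measure_tail tail_subset by (intro sets_J) auto

lemma ring_sets [measurable, simp]: "ring n \<in> sets (lebesgue_on J)"
  using measure_ring ring_subset by (intro sets_J) auto

lemma measure_on_J: "A \<subseteq> J \<Longrightarrow> measure (lebesgue_on J) A = measure lebesgue A"
  by (rule measure_restrict_space) auto

lemma finite_measure_J: "finite_measure (lebesgue_on J)"
  using J_lmeasurable by (rule finite_measure_lebesgue_on)

lemma ring_in_tail: "x \<in> ring k \<Longrightarrow> x \<in> tail n \<longleftrightarrow> n \<le> k"
  using cutpoint_mono[of n k] cutpoint_mono[of "Suc k" n] by (cases "n \<le> k") (auto simp: ring_def tail_def not_less_eq_eq)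

lemma ring_unique: "x \<in> ring k \<Longrightarrow> x \<in> ring n \<longleftrightarrow> n = k"
  using ring_in_tail[of x k n] ring_in_tail[of x k "Suc n"] tail_Suc[of n] ring_subset_tail[of n]
  by auto

text \<open>
  The end point \<open>v\<close> is excluded: if it belongs to \<open>J\<close>, it lies in every tail and in no ring.
\<close>
lemma ring_exists:
  assumes "x \<in> J" "x \<noteq> v"
  obtains n where "x \<in> ring n"
proof -
  have "x < v" using assms J by force
  then obtain N where "(v - u) / (v - x) < 2 ^ N"
    using real_arch_pow[of 2] by auto
  then have "x < cutpoint N"
    using \<open>x < v\<close> uv by (simp add: cutpoint_def field_simps)
  define n where "n = (LEAST n. x < cutpoint n)"
  have n: "x < cutpoint n"
    unfolding n_def using \<open>x < cutpoint N\<close> by (rule LeastI)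
  have "n \<noteq> 0"
  proof
    assume "n = 0"
    then show False
      using n assms(1) J(2) by (auto simp: cutpoint_def)
  qed
  then obtain m where m: "n = Suc m" using not0_implies_Suc by blast
  then have "\<not> x < cutpoint m"
    using not_less_Least[of m "\<lambda>n. x < cutpoint n"] by (simp add: n_def)
  then show thesis
    using that[of m] n m assms by (simp add: ring_def)
qed

lemma AE_neq_v: "AE x in lebesgue_on J. x \<noteq> v"
proof -
  have "AE x in lebesgue. x \<noteq> v"
    by (rule AE_completion) (rule AE_lborel_singleton)
  then show ?thesis
    by (subst AE_restrict_space_iff) auto
qed

section \<open>Functions that are constant on the rings, and means over the chain\<close>

definition ring_step :: "(nat \<Rightarrow> real) \<Rightarrow> real \<Rightarrow> real" where
  "ring_step x t = (\<Sum>n. x n * indicator (ring n) t)"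

lemma ring_step_ring:
  assumes "t \<in> ring n"
  shows "ring_step x t = x n"
proof -
  have "ring_step x t = (\<Sum>k\<in>{n}. x k * indicator (ring k) t)"
    unfolding ring_step_def using ring_unique[OF assms]
    by (intro suminf_finite) auto
  then show ?thesis using assms by simp
qed

lemma ring_step_off: "(\<And>n. t \<notin> ring n) \<Longrightarrow> ring_step x t = 0"
  by (simp add: ring_step_def)

lemma ring_step_summable:
  fixes x :: "nat \<Rightarrow> real"
  shows "summable (\<lambda>n. norm (x n * indicator (ring n) t))"
proof (cases "\<exists>k. t \<in> ring k")
  case True
  then obtain k where "t \<in> ring k" ..
  then show ?thesis
    by (intro summable_finite[of "{k}"]) (auto simp: ring_unique)
qed simp

lemma ring_step_comp:
  assumes "g 0 = 0"
  shows "g (ring_step x t) = ring_step (\<lambda>n. g (x n)) t"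
proof (cases "\<exists>k. t \<in> ring k")
  case True
  then obtain k where "t \<in> ring k" ..
  then show ?thesis by (simp add: ring_step_ring)
qed (simp add: ring_step_off assms)

lemma ring_step_measurable [measurable]: "ring_step x \<in> borel_measurable (lebesgue_on J)"
  unfolding ring_step_def by measurable

lemma ring_step_integral:
  assumes "summable (\<lambda>n. \<bar>x n\<bar> / 2 ^ n)"
  shows "integrable (lebesgue_on J) (ring_step x)"
    and "(\<lambda>n. (v - u) * (x n / 2 ^ Suc n)) sums (LINT t|lebesgue_on J. ring_step x t)"
proof -
  interpret finite_measure "lebesgue_on J" by (rule finite_measure_J)
  have m: "measure (lebesgue_on J) (ring n) = (v - u) / 2 ^ Suc n" for n
    using measure_ring by (simp add: measure_on_J[OF ring_subset])
  have i: "integrable (lebesgue_on J) (\<lambda>t. x n * indicator (ring n) t)" for n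
    by (intro integrable_mult_right integrable_real_indicator) (auto simp: emeasure_eq_measure)
  have "(LINT t|lebesgue_on J. norm (x n * indicator (ring n) t)) = (v - u) / 2 * (\<bar>x n\<bar> / 2 ^ n)" for n
    by (simp add: abs_mult m Int_absorb2 ring_subset)
  then have s: "summable (\<lambda>n. LINT t|lebesgue_on J. norm (x n * indicator (ring n) t))"
    using summable_mult[OF assms, of "(v - u) / 2"] by presburger
  show "integrable (lebesgue_on J) (ring_step x)"
    unfolding ring_step_def using i AE_I2[OF ring_step_summable] s by (rule integrable_suminf)
  have "(\<lambda>n. LINT t|lebesgue_on J. x n * indicator (ring n) t) sums (LINT t|lebesgue_on J. ring_step x t)"
    unfolding ring_step_def using i AE_I2[OF ring_step_summable] s by (rule sums_integral)
  then show "(\<lambda>n. (v - u) * (x n / 2 ^ Suc n)) sums (LINT t|lebesgue_on J. ring_step x t)"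
    by (simp add: m Int_absorb2 ring_subset mult_ac)
qed

lemma ring_step_Lp:
  assumes "wlp p x"
  shows "ring_step x \<in> Lp J p"
    and "(LINT t|lebesgue_on J. \<bar>ring_step x t\<bar> powr p) = (v - u) / 2 * wlp_sum p x"
proof -
  have eq: "\<bar>ring_step x t\<bar> powr p = ring_step (\<lambda>n. \<bar>x n\<bar> powr p) t" for t
    by (rule ring_step_comp) simp
  have s: "summable (\<lambda>n. \<bar>\<bar>x n\<bar> powr p\<bar> / 2 ^ n)"
    using assms by (simp add: wlp_def)
  show "ring_step x \<in> Lp J p"
    unfolding Lp_def mem_Collect_eq eq using ring_step_integral(1)[OF s] ring_step_measurable by blast
  have "(\<lambda>n. (v - u) / 2 * (\<bar>x n\<bar> powr p / 2 ^ n)) sums ((v - u) / 2 * wlp_sum p x)"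
    using assms unfolding wlp_def wlp_sum_def by (intro sums_mult summable_sums)
  then show "(LINT t|lebesgue_on J. \<bar>ring_step x t\<bar> powr p) = (v - u) / 2 * wlp_sum p x"
    unfolding eq using sums_unique2[OF ring_step_integral(2)[OF s]] by (simp add: field_simps)
qed

definition tail_mean :: "(real \<Rightarrow> real) \<Rightarrow> nat \<Rightarrow> real" where
  "tail_mean f n = mean (tail n) f"

lemma integral_on_subset:
  fixes f :: "real \<Rightarrow> real"
  assumes "A \<in> sets lebesgue" "A \<subseteq> J"
  shows "(LINT x|lebesgue_on A. f x) = (LINT x|lebesgue_on J. indicator A x * f x)"
    and "integrable (lebesgue_on A) f \<longleftrightarrow> integrable (lebesgue_on J) (\<lambda>x. indicator A x * f x)"
proof -
  have eq: "indicator J x * (indicator A x * f x) = indicator A x * f x" for x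
    using assms by (auto split: split_indicator)
  show "(LINT x|lebesgue_on A. f x) = (LINT x|lebesgue_on J. indicator A x * f x)"
    using assms by (subst (1 2) integral_restrict_space) (simp_all add: eq)
  show "integrable (lebesgue_on A) f \<longleftrightarrow> integrable (lebesgue_on J) (\<lambda>x. indicator A x * f x)"
    using assms by (subst (1 2) integrable_restrict_space) (simp_all add: eq)
qed

lemma tail_mean_eq: "tail_mean f n = 2 ^ n / (v - u) * (LINT x|lebesgue_on J. indicator (tail n) x * f x)"
  using measure_tail[of n] tail_subset[of n] fmeasurableD[OF measure_tail(1)[of n]]
  by (simp add: tail_mean_def mean_def integral_on_subset(1)[of "tail n" f])

lemma tail_mean_cong:
  assumes "f \<in> borel_measurable (lebesgue_on J)" "g \<in> borel_measurable (lebesgue_on J)"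
    and "AE x in lebesgue_on J. f x = g x"
  shows "tail_mean f n = tail_mean g n"
proof -
  have "(LINT x|lebesgue_on J. indicator (tail n) x * f x)
      = (LINT x|lebesgue_on J. indicator (tail n) x * g x)"
    using assms by (intro integral_cong_AE) auto
  then show ?thesis
    by (simp only: tail_mean_eq)
qed

lemma Lp_integrable:
  assumes p: "1 \<le> p" and f: "f \<in> Lp J p"
  shows "integrable (lebesgue_on J) f"
proof -
  interpret finite_measure "lebesgue_on J" by (rule finite_measure_J)
  have m: "f \<in> borel_measurable (lebesgue_on J)" and i: "integrable (lebesgue_on J) (\<lambda>x. \<bar>f x\<bar> powr p)"
    using f unfolding Lp_def by blast+
  have i1: "integrable (lebesgue_on J) (\<lambda>x. 1 + \<bar>f x\<bar> powr p)"
    using i by (intro Bochner_Integration.integrable_add integrable_const)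
  have le: "norm (f x) \<le> norm (1 + \<bar>f x\<bar> powr p)" for x
    unfolding real_norm_def by (rule order_trans[OF le_1_plus_powr[OF p] abs_ge_self])
  show ?thesis
    by (rule Bochner_Integration.integrable_bound[OF i1 m AE_I2[OF le]])
qed

lemma integrable_indicator_mult:
  fixes f :: "real \<Rightarrow> real"
  assumes "integrable (lebesgue_on J) f" "A \<in> sets (lebesgue_on J)"
  shows "integrable (lebesgue_on J) (\<lambda>x. indicator A x * f x)"
  using integrable_mult_indicator[OF assms(2,1)] by simp

lemma tail_mean_add:
  assumes "integrable (lebesgue_on J) f" "integrable (lebesgue_on J) g"
  shows "tail_mean (\<lambda>x. f x + g x) n = tail_mean f n + tail_mean g n"
  using assms by (simp add: tail_mean_eq distrib_left integrable_indicator_mult)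

lemma tail_mean_scale: "tail_mean (\<lambda>x. t * f x) n = t * tail_mean f n"
proof -
  have "(\<lambda>x. indicator (tail n) x * (t * f x)) = (\<lambda>x. t * (indicator (tail n) x * f x))"
    by (auto simp: mult_ac)
  then show ?thesis
    unfolding tail_mean_eq by (simp only: integral_mult_right_zero) (simp only: mult_ac)
qed

lemma tail_mean_0: "f \<in> Lp_o J p \<Longrightarrow> tail_mean f 0 = 0"
  by (simp add: tail_mean_def mean_def tail_0 Lp_o_def)

lemma integral_tail_split:
  fixes f :: "real \<Rightarrow> real"
  assumes "integrable (lebesgue_on J) f"
  shows "(LINT x|lebesgue_on J. indicator (tail n) x * f x)
    = (LINT x|lebesgue_on J. indicator (ring n) x * f x)
    + (LINT x|lebesgue_on J. indicator (tail (Suc n)) x * f x)"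
proof -
  have "indicator (tail n) x * f x = indicator (ring n) x * f x + indicator (tail (Suc n)) x * f x" for x
    using ring_subset_tail[of n] by (auto simp: tail_Suc split: split_indicator)
  then show ?thesis
    using assms by (simp add: integrable_indicator_mult)
qed

text \<open>
  A Hardy inequality.  The mean over \<open>tail n\<close> is the average of the mean over \<open>ring n\<close> and the mean over
  \<open>tail (n + 1)\<close>.  Passing from index \<open>n + 1\<close> to \<open>n\<close> therefore gains \<open>2 powr (- p)\<close> from the average
  and loses a factor \<open>2\<close> from the weight, which is a contraction for \<open>p > 1\<close>; the means over the disjoint
  rings are controlled by Jensen's inequality.
\<close>
lemma tail_mean_wlp:
  assumes p: "1 < p"
  obtains C where "0 \<le> C" "\<And>f. f \<in> Lp J p \<Longrightarrow> wlp p (tail_mean f)"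
    "\<And>f. f \<in> Lp J p \<Longrightarrow> wlp_sum p (tail_mean f) \<le> C * (LINT x|lebesgue_on J. \<bar>f x\<bar> powr p)"
proof -
  define P where "P = (2::real) powr (p - 1)"
  have P: "1 < P" using p by (simp add: P_def)
  have Pp: "2 powr p = 2 * P" using p by (simp add: P_def powr_diff)
  \<comment> \<open>The contraction factor \<open>1 / P\<close>, enlarged by \<open>1 + \<delta>\<close> with \<open>\<delta> = (P - 1) / 2\<close> small enough to keep
    \<open>q < 1\<close>.\<close>
  define q where "q = (1 + (P - 1) / 2) / P"
  have q: "0 \<le> q" "q < 1" using P by (auto simp: q_def field_simps)
  obtain C where C: "0 \<le> C"
    "\<And>x y::real. \<bar>x + y\<bar> powr p \<le> (1 + (P - 1) / 2) * \<bar>x\<bar> powr p + C * \<bar>y\<bar> powr p"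
    using abs_add_powr_le[of p "(P - 1) / 2"] p P by auto
  define L where "L = v - u"
  have L: "0 < L" using uv by (simp add: L_def)
  define K where "K = (2 powr p / L + 2 * C / L) / (1 - q)"
  have main: "wlp p (tail_mean f) \<and> wlp_sum p (tail_mean f) \<le> K * (LINT x|lebesgue_on J. \<bar>f x\<bar> powr p)"
    if f: "f \<in> Lp J p" for f
  proof -
    interpret finite_measure "lebesgue_on J" by (rule finite_measure_J)
    have i: "integrable (lebesgue_on J) f" "integrable (lebesgue_on J) (\<lambda>x. \<bar>f x\<bar> powr p)"
      using Lp_integrable[OF less_imp_le[OF p] f] f by (simp_all add: Lp_def)
    define a where "a n = (LINT x|lebesgue_on J. indicator (tail n) x * \<bar>f x\<bar> powr p)" for n
    define b where "b n = (LINT x|lebesgue_on J. indicator (ring n) x * \<bar>f x\<bar> powr p)" for n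
    define r where "r n = 2 ^ Suc n / L * (LINT x|lebesgue_on J. indicator (ring n) x * f x)" for n
    have ab: "a n = b n + a (Suc n)" for n
      unfolding a_def b_def by (rule integral_tail_split[OF i(2)])
    have nonneg: "0 \<le> a n" "0 \<le> b n" for n
      unfolding a_def b_def by (auto intro!: integral_nonneg_AE)
    have sumb: "sum b {..<n} = a 0 - a n" for n
    proof (induction n)
      case (Suc n)
      then show ?case using ab[of n] by simp
    qed simp
    have a0: "a 0 = (LINT x|lebesgue_on J. \<bar>f x\<bar> powr p)"
      unfolding a_def by (intro Bochner_Integration.integral_cong) (auto simp: tail_0)
    have mean_le: "\<bar>1 / l * (LINT x|lebesgue_on J. indicator A x * f x)\<bar> powr p
        \<le> 2 powr p / l * (LINT x|lebesgue_on J. indicator A x * \<bar>f x\<bar> powr p)"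
      if A: "A \<in> sets (lebesgue_on J)" "measure (lebesgue_on J) A = l" "0 < l" for A l
    proof -
      have "\<bar>1 / l * (LINT x|lebesgue_on J. indicator A x * f x)\<bar> powr p
        = (1 / l) powr p * \<bar>LINT x|lebesgue_on J. indicator A x * f x\<bar> powr p"
        using A by (simp add: abs_mult powr_mult powr_divide)
      also have "\<dots> \<le> (1 / l) powr p * (2 powr p * l powr (p - 1) * (LINT x|lebesgue_on J. indicator A x * \<bar>f x\<bar> powr p))"
        using powr_integral_le[OF p A(1) _ i] A(2) by (intro mult_left_mono) auto
      also have "\<dots> = 2 powr p / l * (LINT x|lebesgue_on J. indicator A x * \<bar>f x\<bar> powr p)"
        using A by (simp add: powr_divide powr_diff)
      finally show ?thesis .
    qed
    have m_le: "\<bar>tail_mean f n\<bar> powr p \<le> 2 powr p / (L / 2 ^ n) * a n" for n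
      using mean_le[of "tail n" "L / 2 ^ n"] measure_tail[of n] L
      by (simp add: tail_mean_eq L_def a_def measure_on_J[OF tail_subset])
    have r_le: "\<bar>r n\<bar> powr p \<le> 2 powr p / (L / 2 ^ Suc n) * b n" for n
      using mean_le[of "ring n" "L / 2 ^ Suc n"] measure_ring[of n] L
      by (simp add: r_def L_def b_def measure_on_J[OF ring_subset])
    have m_rec: "2 * tail_mean f n = tail_mean f (Suc n) + r n" for n
      unfolding tail_mean_eq r_def L_def integral_tail_split[OF i(1), of n]
      by (simp add: distrib_left add_divide_distrib)
    let ?y = "\<lambda>n. \<bar>tail_mean f n\<bar> powr p / 2 ^ n" and ?e = "\<lambda>n. 2 * C / L * b n"
    have an: "a n \<le> a 0" for n
      using sumb[of n] sum_nonneg[of "{..<n}" b] nonneg by simp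
    \<comment> \<open>Jensen's inequality on \<open>tail n\<close> yields the a priori bound that the backward recursion needs.\<close>
    have y_le: "?y n \<le> 2 powr p / L * a 0" for n
    proof -
      have "?y n \<le> (2 powr p / (L / 2 ^ n) * a n) / 2 ^ n"
        by (intro divide_right_mono m_le) auto
      also have "\<dots> = 2 powr p / L * a n" by simp
      also have "\<dots> \<le> 2 powr p / L * a 0"
        using L an by (intro mult_left_mono) auto
      finally show ?thesis .
    qed
    have e_le: "sum ?e {..<n} \<le> 2 * C / L * a 0" for n
      unfolding sum_distrib_left[symmetric] sumb using nonneg[of n] C(1) L
      by (intro mult_left_mono) auto
    have step: "?y n \<le> q * ?y (Suc n) + ?e n" for n
    proof -
      have "2 powr p * \<bar>tail_mean f n\<bar> powr p = \<bar>tail_mean f (Suc n) + r n\<bar> powr p"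
        unfolding m_rec[symmetric] by (simp add: abs_mult powr_mult)
      also have "\<dots> \<le> (1 + (P - 1) / 2) * \<bar>tail_mean f (Suc n)\<bar> powr p + C * \<bar>r n\<bar> powr p"
        by (rule C(2))
      also have "\<dots> \<le> P * q * \<bar>tail_mean f (Suc n)\<bar> powr p + C * (2 powr p / (L / 2 ^ Suc n) * b n)"
        using C(1) r_le[of n] P by (intro add_mono mult_left_mono) (auto simp: q_def)
      finally have "2 powr p * \<bar>tail_mean f n\<bar> powr p
        \<le> 2 powr p * (q / 2 * \<bar>tail_mean f (Suc n)\<bar> powr p + 2 ^ Suc n * C / L * b n)"
        by (simp add: Pp algebra_simps)
      then have "\<bar>tail_mean f n\<bar> powr p \<le> q / 2 * \<bar>tail_mean f (Suc n)\<bar> powr p + 2 ^ Suc n * C / L * b n"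
        by (rule mult_left_le_imp_le) simp
      from divide_right_mono[OF this, of "2 ^ n"] show ?thesis
        by (simp add: add_divide_distrib)
    qed
    have "summable ?y" "suminf ?y \<le> (2 powr p / L * a 0 + 2 * C / L * a 0) / (1 - q)"
      by (rule summable_of_backward_contraction[OF _ y_le e_le q step]; simp)+
    then show ?thesis
      unfolding K_def wlp_def wlp_sum_def a0[symmetric] by (simp add: algebra_simps)
  qed
  have "0 \<le> K" using q C(1) L by (auto simp: K_def)
  then show thesis
    using that[of K] main by auto
qed

text \<open>
  Since \<open>s n\<close> has to be the average of the value on \<open>ring n\<close> and of \<open>s (n + 1)\<close>, this is the only
  function constant on the rings that can have means \<open>s\<close>.
\<close>
definition from_tail_means :: "(nat \<Rightarrow> real) \<Rightarrow> real \<Rightarrow> real" where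
  "from_tail_means s = ring_step (\<lambda>n. 2 * s n - s (Suc n))"

lemma from_tail_means_ring: "t \<in> ring n \<Longrightarrow> from_tail_means s t = 2 * s n - s (Suc n)"
  unfolding from_tail_means_def by (rule ring_step_ring)

lemma from_tail_means_measurable [measurable]: "from_tail_means x \<in> borel_measurable (lebesgue_on J)"
  unfolding from_tail_means_def by measurable

lemma from_tail_means_Lp:
  assumes p: "1 < p" and s: "wlp p s"
  shows "from_tail_means s \<in> Lp J p"
    and "(LINT t|lebesgue_on J. \<bar>from_tail_means s t\<bar> powr p)
      \<le> (v - u) / 2 * (2 powr p * (2 powr p + 2)) * wlp_sum p s"
proof -
  have d: "wlp p (\<lambda>n. 2 * s n)" "wlp_sum p (\<lambda>n. 2 * s n) \<le> 2 powr p * wlp_sum p s"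
    using wlp_mult[of p s "\<lambda>_. 2" 2] p s by auto
  have m: "wlp p (\<lambda>n. - s (Suc n))" "wlp_sum p (\<lambda>n. - s (Suc n)) \<le> 2 * wlp_sum p s"
    using wlp_shift[OF s] by (auto simp: wlp_def wlp_sum_def)
  note a = wlp_add[OF _ d(1) m(1)]
  have w: "wlp p (\<lambda>n. 2 * s n - s (Suc n))"
    using a(1) p by simp
  show "from_tail_means s \<in> Lp J p"
    unfolding from_tail_means_def using w by (rule ring_step_Lp)
  have "wlp_sum p (\<lambda>n. 2 * s n - s (Suc n)) \<le> 2 powr p * (wlp_sum p (\<lambda>n. 2 * s n) + wlp_sum p (\<lambda>n. - s (Suc n)))"
    using a(2) p by simp
  also have "\<dots> \<le> 2 powr p * (2 powr p * wlp_sum p s + 2 * wlp_sum p s)"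
    using d(2) m(2) by (intro mult_left_mono add_mono) auto
  finally have "wlp_sum p (\<lambda>n. 2 * s n - s (Suc n)) \<le> 2 powr p * (2 powr p + 2) * wlp_sum p s"
    by (simp add: algebra_simps)
  then have "(v - u) / 2 * wlp_sum p (\<lambda>n. 2 * s n - s (Suc n)) \<le> (v - u) / 2 * (2 powr p * (2 powr p + 2) * wlp_sum p s)"
    using uv by (intro mult_left_mono) auto
  then show "(LINT t|lebesgue_on J. \<bar>from_tail_means s t\<bar> powr p)
      \<le> (v - u) / 2 * (2 powr p * (2 powr p + 2)) * wlp_sum p s"
    unfolding from_tail_means_def ring_step_Lp(2)[OF w] by (simp add: mult.assoc)
qed

text \<open>
  The integral over \<open>tail n\<close> telescopes, and the boundary term vanishes because \<open>s k / 2 ^ k\<close> tends to \<open>0\<close>.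
\<close>
lemma tail_mean_from_tail_means:
  assumes s: "summable (\<lambda>n. \<bar>s n\<bar> / 2 ^ n)"
  shows "tail_mean (from_tail_means s) n = s n"
proof -
  \<comment> \<open>Constant up to index \<open>n\<close>, so that the telescoping sum starts contributing at \<open>n\<close>.\<close>
  define F where "F k = s (max k n) / 2 ^ max k n" for k
  define x where "x k = (if n \<le> k then 2 * s k - s (Suc k) else 0)" for k
  have ind: "indicator (tail n) t * from_tail_means s t = ring_step x t" for t
  proof (cases "\<exists>k. t \<in> ring k")
    case True
    then obtain k where "t \<in> ring k" ..
    then show ?thesis
      using ring_in_tail[of t k n] by (simp add: x_def from_tail_means_ring ring_step_ring split: split_indicator)
  qed (simp add: ring_step_off from_tail_means_def)
  have xF: "x k / 2 ^ Suc k = F k - F (Suc k)" for k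
  proof (cases "n \<le> k")
    case True
    then have "max k n = k" "max (Suc k) n = Suc k" by auto
    then show ?thesis using True by (simp add: x_def F_def field_simps)
  next
    case False
    then have "max k n = n" "max (Suc k) n = n" by auto
    then show ?thesis using False by (simp add: x_def F_def)
  qed
  have sx: "summable (\<lambda>k. \<bar>x k\<bar> / 2 ^ k)"
  proof (rule summable_comparison_test'[where N = 0])
    have s': "summable (\<lambda>k. \<bar>s (Suc k)\<bar> / 2 ^ Suc k)"
      using s by (subst summable_Suc_iff)
    show "summable (\<lambda>k. 2 * (\<bar>s k\<bar> / 2 ^ k) + 2 * (\<bar>s (Suc k)\<bar> / 2 ^ Suc k))"
      by (intro summable_add summable_mult s s')
    show "norm (\<bar>x k\<bar> / 2 ^ k) \<le> 2 * (\<bar>s k\<bar> / 2 ^ k) + 2 * (\<bar>s (Suc k)\<bar> / 2 ^ Suc k)" for k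
      by (auto simp: x_def add_divide_distrib[symmetric] intro!: divide_right_mono)
  qed
  have "(\<lambda>k. s k / 2 ^ k) \<longlonglongrightarrow> 0"
    using summable_LIMSEQ_zero[OF s] by (subst tendsto_rabs_zero_iff[symmetric]) (simp add: abs_divide)
  moreover have "eventually (\<lambda>k. s k / 2 ^ k = F k) sequentially"
    using eventually_ge_at_top[of n] by eventually_elim (simp add: F_def max_def)
  ultimately have "F \<longlonglongrightarrow> 0"
    by (rule Lim_transform_eventually)
  then have "(\<lambda>k. x k / 2 ^ Suc k) sums (F 0 - 0)"
    unfolding xF by (rule telescope_sums')
  then have "(\<lambda>k. (v - u) * (x k / 2 ^ Suc k)) sums ((v - u) * (F 0 - 0))"
    by (rule sums_mult)
  from sums_unique2[OF ring_step_integral(2)[OF sx] this]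
  have "(LINT t|lebesgue_on J. ring_step x t) = (v - u) * (s n / 2 ^ n)"
    by (simp add: F_def)
  then show ?thesis
    using uv by (simp add: tail_mean_eq ind)
qed

lemma from_tail_means_off: "(\<And>n. t \<notin> ring n) \<Longrightarrow> from_tail_means s t = 0"
  by (simp add: from_tail_means_def ring_step_off)

lemma from_tail_means_add: "from_tail_means (\<lambda>n. s n + t n) x = from_tail_means s x + from_tail_means t x"
proof (cases "\<exists>n. x \<in> ring n")
  case True
  then obtain n where "x \<in> ring n" ..
  then show ?thesis by (simp add: from_tail_means_ring)
qed (simp add: from_tail_means_off)

lemma from_tail_means_scale: "from_tail_means (\<lambda>n. c * s n) x = c * from_tail_means s x"
proof (cases "\<exists>n. x \<in> ring n")
  case True
  then obtain n where "x \<in> ring n" ..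
  then show ?thesis by (simp add: from_tail_means_ring algebra_simps)
qed (simp add: from_tail_means_off)

lemma from_tail_means_Lp_o:
  assumes p: "1 < p" and s: "wlp p s" "s 0 = 0"
  shows "from_tail_means s \<in> Lp_o J p"
proof -
  have "tail_mean (from_tail_means s) 0 = 0"
    using tail_mean_from_tail_means[of s 0] wlp_abs_summable[of p s] p s by simp
  then show ?thesis
    using from_tail_means_Lp(1)[OF p s(1)] uv measure_J by (simp add: tail_mean_def mean_def tail_0 Lp_o_def)
qed

section \<open>The paraproduct of a symbol on the chain\<close>

lemma AE_J: "(\<And>x. x \<in> J \<Longrightarrow> x \<noteq> v \<Longrightarrow> P x) \<Longrightarrow> AE x in lebesgue_on J. P x"
  using AE_neq_v AE_space[of "lebesgue_on J"] by eventually_elim auto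

lemma dyadic_gen_near_interval:
  assumes "I \<in> dyadic_gen J n"
  obtains s t where "s < t" "{s<..<t} \<subseteq> I" "I \<subseteq> {s..t}"
proof -
  have "\<exists>s t. s < t \<and> {s<..<t} \<subseteq> I \<and> I \<subseteq> {s..t}"
    using assms
  proof (induction n arbitrary: I)
    case 0
    then show ?case using uv J by auto
  next
    case (Suc n)
    then obtain K where K: "K \<in> dyadic_gen J n" "I = left_half K \<or> I = right_half K"
      by auto
    from Suc.IH[OF K(1)] obtain s t where st: "s < t" "{s<..<t} \<subseteq> K" "K \<subseteq> {s..t}"
      by blast
    have "s < (s + t) / 2" "(s + t) / 2 < t" using st by auto
    then show ?case
      using K(2) near_interval_halves[OF st] by blast
  qed
  then show thesis using that by blast
qed

lemma dyadic_gen_cases: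
  assumes "I \<in> dyadic_gen J n"
  obtains (tail) "I = tail n" | (ring) k where "I \<subseteq> ring k"
proof -
  have "I = tail n \<or> (\<exists>k. I \<subseteq> ring k)"
    using assms
  proof (induction n arbitrary: I)
    case 0
    then show ?case by (simp add: tail_0)
  next
    case (Suc n)
    then obtain K where K: "K \<in> dyadic_gen J n" "I = left_half K \<or> I = right_half K"
      by auto
    have "I \<subseteq> K" using K(2) by (auto simp: left_half_def right_half_def)
    with Suc.IH[OF K(1)] K(2) show ?case
      using left_half_tail right_half_tail by (metis order_refl order_trans)
  qed
  then show thesis using that by blast
qed

lemma tail_in_dyadic_gen: "tail n \<in> dyadic_gen J n"
proof (induction n)
  case (Suc n)
  then show ?case by (auto simp: right_half_tail intro!: bexI[of _ "tail n"])
qed (simp add: tail_0)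

lemma finite_dyadic_gen: "finite (dyadic_gen J n)"
  by (induction n) auto

lemma dyadic_gen_measure:
  assumes "I \<in> dyadic_gen J n"
  shows "I \<subseteq> J" "I \<in> lmeasurable" "0 < measure lebesgue I"
    "left_half I \<in> sets (lebesgue_on J)" "right_half I \<in> sets (lebesgue_on J)"
    "measure (lebesgue_on J) (left_half I) = measure (lebesgue_on J) (right_half I)"
proof -
  show IJ: "I \<subseteq> J"
    using assms ring_subset tail_subset by (cases rule: dyadic_gen_cases) blast+
  have sub: "left_half I \<subseteq> J" "right_half I \<subseteq> J"
    using IJ by (auto simp: left_half_def right_half_def)
  obtain s t where st: "s < t" "{s<..<t} \<subseteq> I" "I \<subseteq> {s..t}"
    using assms by (rule dyadic_gen_near_interval)
  note h = near_interval_halves[OF st]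
  have m: "s < (s + t) / 2" "(s + t) / 2 < t" using st by auto
  show "I \<in> lmeasurable" "0 < measure lebesgue I"
    using near_interval[OF st] st by simp_all
  note l = near_interval[OF m(1) h(1,2)] and r = near_interval[OF m(2) h(3,4)]
  show "left_half I \<in> sets (lebesgue_on J)" "right_half I \<in> sets (lebesgue_on J)"
    using l(1) r(1) sub by (auto intro!: sets_J)
  show "measure (lebesgue_on J) (left_half I) = measure (lebesgue_on J) (right_half I)"
    using l(2) r(2) sub by (simp add: measure_on_J field_simps)
qed

text \<open>
  The Haar term on \<open>tail n\<close> changes the mean by \<open>c n\<close> on the way to \<open>tail (n + 1)\<close>, so the symbol with
  terms \<open>c\<close> is the function whose means are the partial sums of \<open>c\<close>.
\<close>
definition symbol :: "(nat \<Rightarrow> real) \<Rightarrow> real \<Rightarrow> real" where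
  "symbol c = from_tail_means (\<lambda>n. \<Sum>k<n. c k)"

context
  fixes c :: "nat \<Rightarrow> real" and B :: real
  assumes c_bound: "\<And>n. \<bar>c n\<bar> \<le> B"
begin

lemma symbol_tail_mean: "tail_mean (symbol c) n = (\<Sum>k<n. c k)"
  unfolding symbol_def
  using wlp_abs_summable[OF _ wlp_partial_sums_bounded[of 2 c B]] c_bound by (intro tail_mean_from_tail_means) auto

lemma symbol_integrable: "integrable (lebesgue_on J) (symbol c)"
proof -
  have "symbol c \<in> Lp J 2"
    unfolding symbol_def using wlp_partial_sums_bounded[of 2 c B] c_bound
    by (intro from_tail_means_Lp(1)) auto
  then show ?thesis by (intro Lp_integrable[of 2]) auto
qed

text \<open>
  Any other dyadic interval lies inside a ring, where the symbol is constant.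
\<close>
lemma haar_coeff_off_tail:
  assumes I: "I \<in> dyadic_gen J n" "I \<noteq> tail n"
  shows "haar_coeff J (symbol c) I = 0"
proof -
  interpret finite_measure "lebesgue_on J" by (rule finite_measure_J)
  obtain k where k: "I \<subseteq> ring k"
    using I by (cases rule: dyadic_gen_cases) auto
  note m = dyadic_gen_measure[OF I(1)]
  define \<beta> where "\<beta> = 2 * (\<Sum>i<k. c i) - (\<Sum>i<Suc k. c i)"
  have "(\<lambda>x. symbol c x * haar I x) = (\<lambda>x. \<beta> * haar I x)"
  proof (rule ext)
    fix x
    show "symbol c x * haar I x = \<beta> * haar I x"
    proof (cases "x \<in> I")
      case True
      then have "x \<in> ring k" using k by auto
      then show ?thesis by (simp only: symbol_def from_tail_means_ring \<beta>_def)
    next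
      case False
      then show ?thesis by (simp add: haar_def left_half_def right_half_def)
    qed
  qed
  then have "haar_coeff J (symbol c) I = \<beta> * (LINT x|lebesgue_on J. haar I x)"
    unfolding haar_coeff_def by simp
  also have "(LINT x|lebesgue_on J. haar I x) = measure lebesgue I powr (-1/2) *
      ((LINT x|lebesgue_on J. indicator (right_half I) x) - (LINT x|lebesgue_on J. indicator (left_half I) x))"
    unfolding haar_def using m(4,5)
    by (subst integral_mult_right_zero, subst Bochner_Integration.integral_diff)
      (auto simp: emeasure_eq_measure intro!: integrable_real_indicator)
  also have "\<dots> = 0"
    using m(4-6) sets.sets_into_space[OF m(4)] sets.sets_into_space[OF m(5)] by (simp add: Int_absorb2)
  finally show ?thesis by simp
qed

lemma haar_tail: "haar (tail n) x = measure lebesgue (tail n) powr (-1/2) *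
    (indicator (tail (Suc n)) x - indicator (ring n) x)"
  by (simp add: haar_def right_half_tail left_half_tail)

lemma haar_coeff_tail:
  "haar_coeff J (symbol c) (tail n) = c n * measure lebesgue (tail n) powr (1/2)"
proof -
  define l where "l = measure lebesgue (tail n)"
  have l: "l = (v - u) / 2 ^ n" "0 < l"
    using measure_tail[of n] uv by (auto simp: l_def)
  define A where "A k = (LINT x|lebesgue_on J. indicator (tail k) x * symbol c x)" for k
  define R where "R = (LINT x|lebesgue_on J. indicator (ring n) x * symbol c x)"
  have A: "A k = (v - u) / 2 ^ k * (\<Sum>i<k. c i)" for k
    using symbol_tail_mean[of k] uv by (simp add: tail_mean_eq A_def field_simps)
  have R: "A n = R + A (Suc n)"
    unfolding A_def R_def by (rule integral_tail_split[OF symbol_integrable])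
  have "haar_coeff J (symbol c) (tail n)
    = (LINT x|lebesgue_on J. l powr (-1/2) *
        (indicator (tail (Suc n)) x * symbol c x - indicator (ring n) x * symbol c x))"
    unfolding haar_coeff_def haar_tail l_def[symmetric]
    by (intro Bochner_Integration.integral_cong) (auto simp: algebra_simps)
  also have "\<dots> = l powr (-1/2) * (A (Suc n) - R)"
    unfolding A_def R_def using symbol_integrable
    by (subst integral_mult_right_zero, subst Bochner_Integration.integral_diff)
      (auto intro!: integrable_indicator_mult)
  also have "A (Suc n) - R = l * c n"
  proof -
    have "A (Suc n) - R = 2 * A (Suc n) - A n" using R by simp
    also have "\<dots> = l * c n" unfolding A l(1) by (simp add: field_simps)
    finally show ?thesis .
  qed
  also have "l powr (-1/2) * (l * c n) = c n * (l powr (-1/2) * l powr 1)"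
    using l(2) by simp
  also have "l powr (-1/2) * l powr 1 = l powr (1/2)"
    by (subst powr_add[symmetric]) simp
  finally show ?thesis by (simp add: l_def)
qed

lemma haar_term_tail: "haar_coeff J (symbol c) (tail n) * haar (tail n) x
    = c n * (indicator (tail (Suc n)) x - indicator (ring n) x)"
proof -
  have "0 < measure lebesgue (tail n)"
    using measure_tail[of n] uv by simp
  then have "measure lebesgue (tail n) powr (1/2) * measure lebesgue (tail n) powr (-1/2) = 1"
    by (subst powr_add[symmetric]) simp
  then show ?thesis
    unfolding haar_coeff_tail haar_tail by (simp add: algebra_simps)
qed

lemma haar_term_le:
  assumes "I \<in> dyadic J"
  shows "\<bar>haar_coeff J (symbol c) I * haar I x\<bar> \<le> B"
proof -
  obtain n where n: "I \<in> dyadic_gen J n"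
    using assms by (auto simp: dyadic_def)
  have B: "0 \<le> B" using c_bound[of 0] by linarith
  show ?thesis
  proof (cases "I = tail n")
    case True
    have "\<bar>indicator (tail (Suc n)) x - indicator (ring n) x :: real\<bar> \<le> 1"
      by (auto simp: tail_Suc split: split_indicator)
    then have "\<bar>c n\<bar> * \<bar>indicator (tail (Suc n)) x - indicator (ring n) x\<bar> \<le> B * 1"
      using B c_bound[of n] by (intro mult_mono) auto
    then show ?thesis
      unfolding True haar_term_tail by (simp add: abs_mult)
  next
    case False
    then show ?thesis
      using haar_coeff_off_tail[OF n False] B by simp
  qed
qed

text \<open>
  At a point of \<open>ring m\<close> the series stops at \<open>n = m\<close>: it adds \<open>c n * m n f\<close> for \<open>n < m\<close> and subtracts
  the term for \<open>n = m\<close>.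
\<close>
lemma paraproduct_eq_from_tail_means:
  assumes "x \<in> J" "x \<noteq> v"
  shows "paraproduct J (symbol c) f x = from_tail_means (\<lambda>n. \<Sum>k<n. c k * tail_mean f k) x"
proof -
  obtain m where m: "x \<in> ring m"
    using assms by (rule ring_exists)
  define \<phi> where "\<phi> n = c n * tail_mean f n" for n
  have inner: "(\<Sum>I\<in>dyadic_gen J n. mean I f * haar_coeff J (symbol c) I * haar I x)
    = \<phi> n * (indicator (tail (Suc n)) x - indicator (ring n) x)" for n
  proof -
    have "(\<Sum>I\<in>dyadic_gen J n. mean I f * haar_coeff J (symbol c) I * haar I x)
      = (\<Sum>I\<in>{tail n}. mean I f * haar_coeff J (symbol c) I * haar I x)"
      using tail_in_dyadic_gen[of n] finite_dyadic_gen[of n] haar_coeff_off_tail[of _ n]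
      by (intro sum.mono_neutral_right) auto
    also have "\<dots> = mean (tail n) f * (haar_coeff J (symbol c) (tail n) * haar (tail n) x)"
      by simp
    finally show ?thesis
      unfolding haar_term_tail by (simp add: \<phi>_def tail_mean_def)
  qed
  have "paraproduct J (symbol c) f x
      = (\<Sum>n. \<phi> n * (indicator (tail (Suc n)) x - indicator (ring n) x))"
    by (simp add: paraproduct_def inner)
  also have "\<dots> = (\<Sum>n<Suc m. \<phi> n * (indicator (tail (Suc n)) x - indicator (ring n) x))"
    using ring_unique[OF m] ring_in_tail[OF m] by (intro suminf_finite) auto
  also have "\<dots> = (\<Sum>n<m. \<phi> n * (indicator (tail (Suc n)) x - indicator (ring n) x)) - \<phi> m"
    using ring_unique[OF m] ring_in_tail[OF m] by simp
  also have "(\<Sum>n<m. \<phi> n * (indicator (tail (Suc n)) x - indicator (ring n) x)) = (\<Sum>n<m. \<phi> n)"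
    using ring_unique[OF m] ring_in_tail[OF m] by (intro sum.cong) auto
  finally show ?thesis
    by (simp add: from_tail_means_ring[OF m] \<phi>_def)
qed

text \<open>
  Inside a ring the symbol is constant.  On \<open>tail n\<close> its distance from the mean grows linearly with the
  number of rings passed, while their lengths decay geometrically.
\<close>
lemma symbol_BMO: "symbol c \<in> BMO_d J"
proof -
  have B: "0 \<le> B" using c_bound[of 0] by linarith
  define s where "s n = (\<Sum>k<n. c k)" for n
  define E where "E k = (real k + 1)\<^sup>2 / 2 ^ Suc k" for k
  have E: "summable E"
  proof -
    have "wlp 2 (\<lambda>n. \<Sum>k<n. 1)"
      by (rule wlp_partial_sums_bounded[of 2 "\<lambda>_. 1" 1]) auto
    then have "summable (\<lambda>n. (real n)\<^sup>2 / 2 ^ n)"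
      by (simp add: wlp_def)
    then have "summable (\<lambda>n. (real (Suc n))\<^sup>2 / 2 ^ Suc n)"
      by (subst summable_Suc_iff)
    then show ?thesis by (simp add: E_def[abs_def] add.commute)
  qed
  have E0: "0 \<le> suminf E"
    using E by (rule suminf_nonneg) (simp add: E_def)
  define C where "C = B\<^sup>2 * suminf E"
  have C: "0 \<le> C" using E0 by (simp add: C_def)
  have main: "integrable (lebesgue_on K) (\<lambda>x. \<bar>symbol c x - mean K (symbol c)\<bar>\<^sup>2) \<and>
      (LINT x|lebesgue_on K. \<bar>symbol c x - mean K (symbol c)\<bar>\<^sup>2) \<le> C * measure lebesgue K"
    if K_dyadic: "K \<in> dyadic J" for K
  proof -
    obtain n where n: "K \<in> dyadic_gen J n"
      using K_dyadic by (auto simp: dyadic_def)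
    note K = dyadic_gen_measure(1-3)[OF n]
    show ?thesis
      using n
    proof (cases rule: dyadic_gen_cases)
      case (ring k)
      define \<beta> where "\<beta> = 2 * s k - s (Suc k)"
      have \<beta>: "symbol c x = \<beta>" if "x \<in> K" for x
        using that ring unfolding symbol_def \<beta>_def s_def by (intro from_tail_means_ring) auto
      have "(LINT x|lebesgue_on K. symbol c x) = (LINT x|lebesgue_on K. \<beta>)"
        using \<beta> by (intro Bochner_Integration.integral_cong) auto
      also have "\<dots> = \<beta> * measure lebesgue K"
        using K(2) by (simp add: measure_restrict_space fmeasurableD)
      finally have mean: "mean K (symbol c) = \<beta>"
        using K(3) by (simp add: mean_def)
      have zero: "\<bar>symbol c x - mean K (symbol c)\<bar>\<^sup>2 = 0" if "x \<in> space (lebesgue_on K)" for x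
        using \<beta> that by (simp add: mean)
      have "integrable (lebesgue_on K) (\<lambda>x. \<bar>symbol c x - mean K (symbol c)\<bar>\<^sup>2)"
        by (subst Bochner_Integration.integrable_cong[OF refl zero]) auto
      moreover have "(LINT x|lebesgue_on K. \<bar>symbol c x - mean K (symbol c)\<bar>\<^sup>2) = 0"
        by (subst Bochner_Integration.integral_cong[OF refl zero]) auto
      ultimately show ?thesis using C K(3) by simp
    next
      case tail
      have mean: "mean K (symbol c) = s n"
        using symbol_tail_mean[of n] by (simp add: tail tail_mean_def s_def)
      define y where "y k = (if n \<le> k then (2 * s k - s (Suc k) - s n)\<^sup>2 else 0)" for k
      have ae: "AE x in lebesgue_on J. indicator (tail n) x * \<bar>symbol c x - s n\<bar>\<^sup>2 = ring_step y x"
      proof (rule AE_J)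
        fix x assume "x \<in> J" "x \<noteq> v"
        then obtain k where k: "x \<in> ring k" by (rule ring_exists)
        have "symbol c x = 2 * s k - s (Suc k)"
          using k unfolding symbol_def s_def by (rule from_tail_means_ring)
        then show "indicator (tail n) x * \<bar>symbol c x - s n\<bar>\<^sup>2 = ring_step y x"
          using ring_in_tail[OF k, of n] by (simp add: ring_step_ring[OF k] y_def)
      qed
      have m: "symbol c \<in> borel_measurable (lebesgue_on J)"
        using symbol_integrable by auto
      have y_le: "y (k + n) \<le> B\<^sup>2 * (real k + 1)\<^sup>2" for k
      proof -
        have s: "\<bar>s (k + n) - s n\<bar> \<le> real k * B"
        proof (induction k)
          case (Suc k)
          have "s (Suc k + n) - s n = (s (k + n) - s n) + c (k + n)"
            by (simp add: s_def)
          then show ?case using Suc c_bound[of "k + n"] by (simp add: algebra_simps)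
        qed simp
        have "2 * s (k + n) - s (Suc (k + n)) - s n = (s (k + n) - s n) - c (k + n)"
          by (simp add: s_def)
        then have "\<bar>2 * s (k + n) - s (Suc (k + n)) - s n\<bar> \<le> B * (real k + 1)"
          using s c_bound[of "k + n"] by (simp add: algebra_simps)
        then have "\<bar>2 * s (k + n) - s (Suc (k + n)) - s n\<bar>\<^sup>2 \<le> (B * (real k + 1))\<^sup>2"
          by (intro power_mono) auto
        then show ?thesis by (simp add: y_def power_mult_distrib)
      qed
      have y0: "0 \<le> y k" for k by (simp add: y_def)
      have z_le: "y (k + n) / 2 ^ Suc (k + n) \<le> B\<^sup>2 / 2 ^ n * E k" for k
        using divide_right_mono[OF y_le[of k], of "2 ^ Suc (k + n)"]
        by (simp add: E_def power_add mult_ac)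
      have sE: "summable (\<lambda>k. B\<^sup>2 / 2 ^ n * E k)"
        using E by (rule summable_mult)
      have sz: "summable (\<lambda>k. y (k + n) / 2 ^ Suc (k + n))"
        using sE by (rule summable_comparison_test'[where N = 0]) (use z_le y0 in simp)
      then have sy: "summable (\<lambda>k. y k / 2 ^ Suc k)"
        using summable_iff_shift[of "\<lambda>k. y k / 2 ^ Suc k" n] by simp
      have "summable (\<lambda>k. 2 * (y k / 2 ^ Suc k))"
        using sy by (rule summable_mult)
      then have sy': "summable (\<lambda>k. \<bar>y k\<bar> / 2 ^ k)"
        using y0 by simp
      have "(\<Sum>k. y k / 2 ^ Suc k) = (\<Sum>k. y (k + n) / 2 ^ Suc (k + n)) + (\<Sum>k<n. y k / 2 ^ Suc k)"
        using sy by (rule suminf_split_initial_segment)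
      also have "(\<Sum>k<n. y k / 2 ^ Suc k) = 0"
        by (simp add: y_def)
      also have "(\<Sum>k. y (k + n) / 2 ^ Suc (k + n)) \<le> (\<Sum>k. B\<^sup>2 / 2 ^ n * E k)"
        by (intro suminf_le z_le sz sE)
      also have "\<dots> = C / 2 ^ n"
        using suminf_mult[OF E, of "B\<^sup>2 / 2 ^ n"] by (simp add: C_def)
      finally have sum_le: "(\<Sum>k. y k / 2 ^ Suc k) \<le> C / 2 ^ n" by simp
      have "(LINT x|lebesgue_on J. ring_step y x) = (v - u) * (\<Sum>k. y k / 2 ^ Suc k)"
        using sums_unique2[OF ring_step_integral(2)[OF sy'] sums_mult[OF summable_sums[OF sy]]] .
      also have "\<dots> \<le> (v - u) * (C / 2 ^ n)"
        using uv sum_le by (intro mult_left_mono) auto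
      also have "\<dots> = C * measure lebesgue K"
        by (simp add: tail measure_tail)
      finally have le: "(LINT x|lebesgue_on J. ring_step y x) \<le> C * measure lebesgue K" .
      have K': "K \<in> sets lebesgue" using K(2) by auto
      show ?thesis
        unfolding integral_on_subset[OF K' K(1)] mean
        using integrable_cong_AE[OF _ _ ae] integral_cong_AE[OF _ _ ae] m ring_step_integral(1)[OF sy'] le
        by (simp add: tail)
    qed
  qed
  then show ?thesis
    using symbol_integrable by (auto simp: BMO_d_def)
qed

end

section \<open>Invertibility and the recursion\<close>

text \<open>
  The operators \<open>Id - \<mu> \<pi>\<close> and the inverse constructed below both add to their argument a function
  that is constant on the rings.  The series that defines the paraproduct can diverge at the
  end point \<open>v\<close>, so the formula is required only at the other points.
\<close>
lemma Lp_o_perturbation: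
  assumes p: "1 < p" and f: "f \<in> Lp_o J p" and s: "wlp p s" "s 0 = 0"
    and g: "\<And>x. x \<in> J \<Longrightarrow> x \<noteq> v \<Longrightarrow> g x = f x + from_tail_means s x"
  shows "g \<in> Lp_o J p" "tail_mean g n = tail_mean f n + s n"
    and "(LINT x|lebesgue_on J. \<bar>g x\<bar> powr p) \<le> 2 powr p *
      ((LINT x|lebesgue_on J. \<bar>f x\<bar> powr p) + (v - u) / 2 * (2 powr p * (2 powr p + 2)) * wlp_sum p s)"
proof -
  let ?h = "\<lambda>x. f x + from_tail_means s x"
  have fL: "f \<in> Lp J p" using f by (simp add: Lp_o_def)
  have sL: "from_tail_means s \<in> Lp J p" using p s by (intro from_tail_means_Lp)
  have hL: "?h \<in> Lp J p"
    using p by (intro Lp_add fL sL) auto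
  have hm: "?h \<in> borel_measurable (lebesgue_on J)"
    using hL by (simp add: Lp_def)
  have gm: "g \<in> borel_measurable (lebesgue_on J)"
    using hm by (rule measurable_discrete_difference[where X = "J \<inter> {v}"])
      (use g in \<open>auto simp: sets_restrict_space_iff\<close>)
  have ae: "AE x in lebesgue_on J. g x = ?h x"
    by (rule AE_J) (rule g)
  have iff: "integrable (lebesgue_on J) (\<lambda>x. \<bar>g x\<bar> powr p) \<longleftrightarrow> integrable (lebesgue_on J) (\<lambda>x. \<bar>?h x\<bar> powr p)"
    using ae gm hm by (intro integrable_cong_AE) auto
  then have gL: "g \<in> Lp J p"
    using hL gm by (simp add: Lp_def)
  show t: "tail_mean g n = tail_mean f n + s n" for n
  proof -
    have "tail_mean g n = tail_mean ?h n"
      by (rule tail_mean_cong[OF gm hm ae])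
    also have "\<dots> = tail_mean f n + tail_mean (from_tail_means s) n"
      using p by (intro tail_mean_add Lp_integrable[of p] fL sL) auto
    also have "tail_mean (from_tail_means s) n = s n"
      using p s by (intro tail_mean_from_tail_means wlp_abs_summable[of p]) auto
    finally show ?thesis .
  qed
  have "tail_mean g 0 = 0"
    using t[of 0] tail_mean_0[OF f] s by simp
  then show "g \<in> Lp_o J p"
    using gL uv measure_J by (simp add: tail_mean_def mean_def tail_0 Lp_o_def)
  have "(LINT x|lebesgue_on J. \<bar>g x\<bar> powr p) = (LINT x|lebesgue_on J. \<bar>?h x\<bar> powr p)"
    using ae gm hm by (intro integral_cong_AE) auto
  also have "\<dots> \<le> 2 powr p * ((LINT x|lebesgue_on J. \<bar>f x\<bar> powr p) + (LINT x|lebesgue_on J. \<bar>from_tail_means s x\<bar> powr p))"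
    using p by (intro Lp_add fL sL) auto
  also have "\<dots> \<le> 2 powr p *
      ((LINT x|lebesgue_on J. \<bar>f x\<bar> powr p) + (v - u) / 2 * (2 powr p * (2 powr p + 2)) * wlp_sum p s)"
    using from_tail_means_Lp(2)[OF p s(1)] by (intro mult_left_mono add_left_mono) auto
  finally show "(LINT x|lebesgue_on J. \<bar>g x\<bar> powr p) \<le> 2 powr p *
      ((LINT x|lebesgue_on J. \<bar>f x\<bar> powr p) + (v - u) / 2 * (2 powr p * (2 powr p + 2)) * wlp_sum p s)" .
qed

lemma Lp_o_add:
  assumes "1 < p" "f \<in> Lp_o J p" "g \<in> Lp_o J p"
  shows "(\<lambda>x. f x + g x) \<in> Lp_o J p"
  using assms Lp_integrable[of p f] Lp_integrable[of p g] by (auto simp: Lp_o_def intro: Lp_add)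

lemma Lp_o_scale: "f \<in> Lp_o J p \<Longrightarrow> (\<lambda>x. t * f x) \<in> Lp_o J p"
  by (auto simp: Lp_o_def intro: Lp_scale)

lemma perturbation_bounded_op:
  assumes p: "1 < p"
    and T: "\<And>f x. f \<in> Lp_o J p \<Longrightarrow> x \<in> J \<Longrightarrow> x \<noteq> v \<Longrightarrow> T f x = f x + from_tail_means (\<sigma> f) x"
    and add: "\<And>f g n. f \<in> Lp_o J p \<Longrightarrow> g \<in> Lp_o J p \<Longrightarrow> \<sigma> (\<lambda>x. f x + g x) n = \<sigma> f n + \<sigma> g n"
    and scale: "\<And>t f n. f \<in> Lp_o J p \<Longrightarrow> \<sigma> (\<lambda>x. t * f x) n = t * \<sigma> f n"
    and zero: "\<And>f. f \<in> Lp_o J p \<Longrightarrow> \<sigma> f 0 = 0"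
    and wlp: "\<And>f. f \<in> Lp_o J p \<Longrightarrow> wlp p (\<sigma> f)"
    and C: "0 \<le> C" "\<And>f. f \<in> Lp_o J p \<Longrightarrow> wlp_sum p (\<sigma> f) \<le> C * (LINT x|lebesgue_on J. \<bar>f x\<bar> powr p)"
  shows "bounded_op_Lp_o J p T"
  unfolding bounded_op_Lp_o_def
proof (intro conjI ballI allI)
  fix f assume f: "f \<in> Lp_o J p"
  show "T f \<in> Lp_o J p"
    by (rule Lp_o_perturbation(1)[OF p f wlp[OF f] zero[OF f] T[OF f]])
next
  fix f g assume f: "f \<in> Lp_o J p" and g: "g \<in> Lp_o J p"
  have fg: "(\<lambda>x. f x + g x) \<in> Lp_o J p" by (rule Lp_o_add[OF p f g])
  have "\<sigma> (\<lambda>x. f x + g x) = (\<lambda>n. \<sigma> f n + \<sigma> g n)"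
    using add[OF f g] by auto
  then show "AE x in lebesgue_on J. T (\<lambda>y. f y + g y) x = T f x + T g x"
    by (intro AE_J) (simp add: T f g fg from_tail_means_add)
next
  fix t f assume f: "f \<in> Lp_o J p"
  have tf: "(\<lambda>x. t * f x) \<in> Lp_o J p" by (rule Lp_o_scale[OF f])
  have "\<sigma> (\<lambda>x. t * f x) = (\<lambda>n. t * \<sigma> f n)"
    using scale[OF f] by auto
  then show "AE x in lebesgue_on J. T (\<lambda>y. t * f y) x = t * T f x"
    by (intro AE_J) (simp add: T f tf from_tail_means_scale distrib_left)
next
  define D where "D = (v - u) / 2 * (2 powr p * (2 powr p + 2))"
  have D: "0 \<le> D" using uv by (simp add: D_def)
  define M where "M = 2 powr p * (1 + D * C)"
  have M: "0 \<le> M" using D C by (simp add: M_def)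
  show "\<exists>K. \<forall>f\<in>Lp_o J p. Lp_norm J p (T f) \<le> K * Lp_norm J p f"
  proof (intro exI ballI)
    fix f assume f: "f \<in> Lp_o J p"
    let ?N = "LINT x|lebesgue_on J. \<bar>f x\<bar> powr p"
    have N: "0 \<le> ?N" by (intro integral_nonneg_AE) auto
    have "(LINT x|lebesgue_on J. \<bar>T f x\<bar> powr p) \<le> 2 powr p * (?N + D * wlp_sum p (\<sigma> f))"
      unfolding D_def by (rule Lp_o_perturbation(3)[OF p f wlp[OF f] zero[OF f] T[OF f]])
    also have "\<dots> \<le> 2 powr p * (?N + D * (C * ?N))"
      using D C(2)[OF f] by (intro mult_left_mono add_left_mono) auto
    also have "\<dots> = M * ?N"
      by (simp add: M_def algebra_simps)
    finally have "(LINT x|lebesgue_on J. \<bar>T f x\<bar> powr p) powr (1 / p) \<le> (M * ?N) powr (1 / p)"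
      using p by (intro powr_mono2 integral_nonneg_AE) auto
    then show "Lp_norm J p (T f) \<le> M powr (1 / p) * Lp_norm J p f"
      using M N by (simp add: Lp_norm_def powr_mult)
  qed
qed

text \<open>
  The inverse is \<open>S g = g + \<pi> f\<close>, where the means of the unknown \<open>f\<close>, the only data of \<open>f\<close> that \<open>\<pi> f\<close>
  depends on, are computed from \<open>g\<close> by the recursion.
\<close>
lemma recursion_stable_imp_invertible:
  assumes p: "1 < p" and c: "\<And>n. \<bar>c n\<bar> \<le> B" and stable: "recursion_stable p c"
  shows "invertible_Lp_o J p (\<lambda>f x. f x - paraproduct J (symbol c) f x)"
proof -
  let ?T = "\<lambda>f x. f x - paraproduct J (symbol c) f x"
  define \<sigma> where "\<sigma> f n = - (\<Sum>k<n. c k * tail_mean f k)" for f n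
  define \<tau> where "\<tau> g n = (\<Sum>k<n. c k * mean_recursion c (tail_mean g) k)" for g n
  define S where "S g x = g x + from_tail_means (\<tau> g) x" for g x
  have p0: "0 < p" "0 \<le> p" using p by auto
  have B: "0 \<le> B" using c[of 0] by linarith
  obtain C1 where C1: "0 \<le> C1" "\<And>f. f \<in> Lp J p \<Longrightarrow> wlp p (tail_mean f)"
    "\<And>f. f \<in> Lp J p \<Longrightarrow> wlp_sum p (tail_mean f) \<le> C1 * (LINT x|lebesgue_on J. \<bar>f x\<bar> powr p)"
    using tail_mean_wlp[OF p] by blast
  obtain C2 where C2: "0 \<le> C2" "\<And>x. wlp p x \<Longrightarrow> wlp p (\<lambda>n. \<Sum>k<n. x k)"
    "\<And>x. wlp p x \<Longrightarrow> wlp_sum p (\<lambda>n. \<Sum>k<n. x k) \<le> C2 * wlp_sum p x"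
    using wlp_partial_sums[OF p0(1)] by blast
  obtain C3 where C3: "0 \<le> C3" "\<And>d. wlp p d \<Longrightarrow> wlp p (mean_recursion c d)"
    "\<And>d. wlp p d \<Longrightarrow> wlp_sum p (mean_recursion c d) \<le> C3 * wlp_sum p d"
    using stable unfolding recursion_stable_def by blast
  have sums: "wlp p (\<lambda>n. \<Sum>k<n. c k * x k)"
    "wlp_sum p (\<lambda>n. \<Sum>k<n. c k * x k) \<le> C2 * (B powr p * wlp_sum p x)" if x: "wlp p x" for x
  proof -
    note cx = wlp_mult[of p x c B, OF p0(2) x c]
    show "wlp p (\<lambda>n. \<Sum>k<n. c k * x k)" by (rule C2(2)[OF cx(1)])
    show "wlp_sum p (\<lambda>n. \<Sum>k<n. c k * x k) \<le> C2 * (B powr p * wlp_sum p x)"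
      using C2(3)[OF cx(1)] mult_left_mono[OF cx(2) C2(1)] by (rule order_trans)
  qed
  have Lp: "f \<in> Lp J p" if "f \<in> Lp_o J p" for f using that by (simp add: Lp_o_def)
  have int: "integrable (lebesgue_on J) f" if "f \<in> Lp_o J p" for f
    using Lp_integrable[OF less_imp_le[OF p] Lp[OF that]] .
  have tadd: "tail_mean (\<lambda>x. f x + g x) = (\<lambda>n. tail_mean f n + tail_mean g n)"
    if "f \<in> Lp_o J p" "g \<in> Lp_o J p" for f g
    using tail_mean_add[OF int[OF that(1)] int[OF that(2)]] by auto
  have tscale: "tail_mean (\<lambda>x. t * f x) = (\<lambda>n. t * tail_mean f n)" for t f
    using tail_mean_scale by auto
  have \<sigma>: "\<sigma> f 0 = 0" "wlp p (\<sigma> f)"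
    "wlp_sum p (\<sigma> f) \<le> C2 * B powr p * C1 * (LINT x|lebesgue_on J. \<bar>f x\<bar> powr p)"
    if "f \<in> Lp_o J p" for f
  proof -
    show "\<sigma> f 0 = 0" by (simp add: \<sigma>_def)
    have eq: "wlp p (\<sigma> f) = wlp p (\<lambda>n. \<Sum>k<n. c k * tail_mean f k)"
      "wlp_sum p (\<sigma> f) = wlp_sum p (\<lambda>n. \<Sum>k<n. c k * tail_mean f k)"
      by (simp_all add: wlp_def wlp_sum_def \<sigma>_def)
    note m = sums[OF C1(2)[OF Lp[OF that]]]
    show "wlp p (\<sigma> f)" using m(1) eq by simp
    have "C2 * (B powr p * wlp_sum p (tail_mean f)) \<le> C2 * (B powr p * (C1 * (LINT x|lebesgue_on J. \<bar>f x\<bar> powr p)))"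
      using C1(3)[OF Lp[OF that]] C2(1) by (intro mult_left_mono) auto
    then show "wlp_sum p (\<sigma> f) \<le> C2 * B powr p * C1 * (LINT x|lebesgue_on J. \<bar>f x\<bar> powr p)"
      using m(2) eq by (simp add: mult.assoc)
  qed
  have \<tau>: "\<tau> g 0 = 0" "wlp p (\<tau> g)"
    "wlp_sum p (\<tau> g) \<le> C2 * B powr p * C3 * C1 * (LINT x|lebesgue_on J. \<bar>g x\<bar> powr p)"
    if "g \<in> Lp_o J p" for g
  proof -
    show "\<tau> g 0 = 0" by (simp add: \<tau>_def)
    note t = C1(2)[OF Lp[OF that]]
    note m = sums[OF C3(2)[OF t]]
    show "wlp p (\<tau> g)" using m(1) unfolding \<tau>_def[abs_def] .
    have "C2 * (B powr p * wlp_sum p (mean_recursion c (tail_mean g)))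
        \<le> C2 * (B powr p * (C3 * wlp_sum p (tail_mean g)))"
      using C3(3)[OF t] C2(1) by (intro mult_left_mono) auto
    also have "\<dots> \<le> C2 * (B powr p * (C3 * (C1 * (LINT x|lebesgue_on J. \<bar>g x\<bar> powr p))))"
      using C1(3)[OF Lp[OF that]] C2(1) C3(1) by (intro mult_left_mono) auto
    finally show "wlp_sum p (\<tau> g) \<le> C2 * B powr p * C3 * C1 * (LINT x|lebesgue_on J. \<bar>g x\<bar> powr p)"
      using m(2) unfolding \<tau>_def[abs_def] by (simp add: mult.assoc)
  qed
  have T: "?T f x = f x + from_tail_means (\<sigma> f) x" if "x \<in> J" "x \<noteq> v" for f x
  proof -
    have "\<sigma> f = (\<lambda>n. -1 * (\<Sum>k<n. c k * tail_mean f k))" by (auto simp: \<sigma>_def)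
    then have "from_tail_means (\<sigma> f) x = - from_tail_means (\<lambda>n. \<Sum>k<n. c k * tail_mean f k) x"
      by (simp only: from_tail_means_scale)
    then show ?thesis using paraproduct_eq_from_tail_means[OF c that] by simp
  qed
  have bT: "bounded_op_Lp_o J p ?T"
  proof (rule perturbation_bounded_op[OF p, where \<sigma> = \<sigma>])
    show "0 \<le> C2 * B powr p * C1" using C1 C2 by simp
  qed (use T \<sigma> in \<open>auto simp: \<sigma>_def tadd tscale sum.distrib sum_distrib_left algebra_simps\<close>)
  have bS: "bounded_op_Lp_o J p S"
  proof (rule perturbation_bounded_op[OF p, where \<sigma> = \<tau>])
    show "0 \<le> C2 * B powr p * C3 * C1" using C1 C2 C3 by simp
  qed (use \<tau> in \<open>auto simp: S_def \<tau>_def tadd tscale mean_recursion_add mean_recursion_scale sum.distrib sum_distrib_left algebra_simps\<close>)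
  have TS: "AE x in lebesgue_on J. ?T (S f) x = f x" if f: "f \<in> Lp_o J p" for f
  proof (rule AE_J)
    fix x assume x: "x \<in> J" "x \<noteq> v"
    have "tail_mean (S f) n = mean_recursion c (tail_mean f) n" for n
      using Lp_o_perturbation(2)[OF p f \<tau>(2)[OF f] \<tau>(1)[OF f] S_def]
      by (simp add: mean_recursion_eq_add_sum[of c "tail_mean f" n] \<tau>_def)
    then have "\<sigma> (S f) = (\<lambda>n. -1 * \<tau> f n)"
      by (auto simp: \<sigma>_def \<tau>_def)
    then have "from_tail_means (\<sigma> (S f)) x = - from_tail_means (\<tau> f) x"
      by (simp only: from_tail_means_scale)
    then show "?T (S f) x = f x"
      using T[OF x, of "S f"] by (simp add: S_def)
  qed
  have ST: "AE x in lebesgue_on J. S (?T f) x = f x" if f: "f \<in> Lp_o J p" for f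
  proof (rule AE_J)
    fix x assume x: "x \<in> J" "x \<noteq> v"
    have t: "tail_mean (?T f) n = tail_mean f n + \<sigma> f n" for n
      using Lp_o_perturbation(2)[OF p f \<sigma>(2)[OF f] \<sigma>(1)[OF f] T] by simp
    have "mean_recursion c (tail_mean (?T f)) n = tail_mean f n" for n
      by (rule mean_recursion_unique) (simp add: t \<sigma>_def)
    then have "\<tau> (?T f) = (\<lambda>n. -1 * \<sigma> f n)"
      by (auto simp: \<sigma>_def \<tau>_def)
    then have "from_tail_means (\<tau> (?T f)) x = - from_tail_means (\<sigma> f) x"
      by (simp only: from_tail_means_scale)
    then show "S (?T f) x = f x"
      using T[OF x, of f] by (simp add: S_def)
  qed
  show ?thesis
    unfolding invertible_Lp_o_def using bT bS TS ST by blast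
qed

text \<open>
  The jump \<open>d\<close> is the sequence of means of the Haar function of \<open>J\<close>, up to a constant.  A preimage in
  \<open>L\<^sup>p\<close> would have means that solve the recursion, and by the Hardy inequality they would lie in the
  weighted space.
\<close>
lemma not_invertible:
  assumes p: "1 < p" and c: "\<And>n. \<bar>c n\<bar> \<le> B"
    and d: "d 0 = 0" "\<And>n. d (Suc n) = 1"
    and blowup: "\<not> wlp p (mean_recursion (\<lambda>n. lam * c n) d)"
  shows "\<not> invertible_Lp_o J p (\<lambda>f x. f x - lam * paraproduct J (symbol c) f x)"
proof
  let ?T = "\<lambda>f x. f x - lam * paraproduct J (symbol c) f x"
  assume inv: "invertible_Lp_o J p ?T"
  have p0: "0 < p" "0 \<le> p" using p by auto
  have "\<bar>d n\<bar> \<le> 1" for n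
    using d by (cases n) auto
  then have dw: "wlp p d" using wlp_bounded[OF p0(2)] by blast
  define g where "g = from_tail_means d"
  have g: "g \<in> Lp_o J p" unfolding g_def using p dw d(1) by (rule from_tail_means_Lp_o)
  have tg: "tail_mean g n = d n" for n
    unfolding g_def using p dw by (intro tail_mean_from_tail_means wlp_abs_summable[of p]) auto
  obtain f where f: "f \<in> Lp_o J p" "AE x in lebesgue_on J. ?T f x = g x" "?T f \<in> Lp_o J p"
    using inv g unfolding invertible_Lp_o_def bounded_op_Lp_o_def by blast
  have fL: "f \<in> Lp J p" using f by (simp add: Lp_o_def)
  have tw: "wlp p (tail_mean f)" using tail_mean_wlp[OF p] fL by metis
  define s where "s n = - lam * (\<Sum>k<n. c k * tail_mean f k)" for n
  have s: "wlp p s" "s 0 = 0"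
  proof -
    obtain C where C: "\<And>x. wlp p x \<Longrightarrow> wlp p (\<lambda>n. \<Sum>k<n. x k)"
      using wlp_partial_sums[OF p0(1)] by blast
    have "wlp p (\<lambda>n. \<Sum>k<n. c k * tail_mean f k)"
      by (rule C[OF wlp_mult(1)[of p "tail_mean f" c B, OF p0(2) tw c]])
    then show "wlp p s"
      unfolding s_def[abs_def] by (rule wlp_mult(1)[OF p0(2) _ order_refl])
  qed (simp add: s_def)
  have T: "?T f x = f x + from_tail_means s x" if "x \<in> J" "x \<noteq> v" for x
    unfolding s_def[abs_def] from_tail_means_scale using paraproduct_eq_from_tail_means[OF c that] by simp
  have tf: "tail_mean f n = d n + (\<Sum>k<n. (lam * c k) * tail_mean f k)" for n
  proof -
    have "tail_mean (?T f) n = tail_mean g n"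
      using f(2,3) g by (intro tail_mean_cong) (auto simp: Lp_o_def Lp_def)
    then have "tail_mean f n + s n = d n"
      using Lp_o_perturbation(2)[OF p f(1) s T] tg by simp
    moreover have "(\<Sum>k<n. (lam * c k) * tail_mean f k) = - s n"
      by (simp add: s_def sum_distrib_left mult.assoc sum_negf)
    ultimately show ?thesis by simp
  qed
  have "mean_recursion (\<lambda>n. lam * c n) d = tail_mean f"
    by (intro ext mean_recursion_unique) (rule tf)
  then show False using blowup tw by simp
qed

end

theorem theorem1p4:
  fixes J :: "real set"
  assumes "is_interval J" and "bounded J" and "interior J \<noteq> {}"
  shows "\<forall>p::real. 1 < p \<longrightarrow>
    (\<exists>(lam::real) (b::real \<Rightarrow> real) (eps::real).
       0 < lam \<and> lam < 1 \<and> b \<in> BMO_d J \<and> 0 < eps \<and>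
       (\<forall>I\<in>dyadic J. \<forall>x. \<bar>haar_coeff J b I * haar I x\<bar> \<le> 1 - eps) \<and>
       invertible_Lp_o J p (\<lambda>f x. f x - paraproduct J b f x) \<and>
       \<not> invertible_Lp_o J p (\<lambda>f x. f x - lam * paraproduct J b f x))"
proof (intro allI impI)
  fix p :: real assume p: "1 < p"
  have bdd: "bdd_below J" "bdd_above J"
    using assms(2) by (auto simp: bounded_imp_bdd_below bounded_imp_bdd_above)
  obtain z e where ze: "0 < e" "ball z e \<subseteq> J"
    using assms(3) by (auto simp: mem_interior)
  have J_ne: "J \<noteq> {}" using ze by auto
  have near: "z - e / 2 \<in> J" "z + e / 2 \<in> J"
    using ze by (auto simp: subset_iff dist_real_def)
  interpret bounded_interval J "Inf J" "Sup J"
  proof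
    show "Inf J < Sup J"
      using cInf_lower[OF near(1) bdd(1)] cSup_upper[OF near(2) bdd(2)] ze(1) by linarith
    show "J \<subseteq> {Inf J..Sup J}"
      using cInf_lower[OF _ bdd(1)] cSup_upper[OF _ bdd(2)] by auto
    show "{Inf J<..<Sup J} \<subseteq> J"
    proof
      fix x assume "x \<in> {Inf J<..<Sup J}"
      then obtain a b where "a \<in> J" "a < x" "b \<in> J" "x < b"
        using cInf_lessD[OF J_ne] less_cSupD[OF J_ne] by (metis greaterThanLessThan_iff)
      then show "x \<in> J"
        using assms(1) unfolding is_interval_1 by (meson less_imp_le)
    qed
  qed
  obtain \<kappa> a j where par: "0 < \<kappa>" "\<kappa> < a" "a < 1" "2 \<le> (1 + \<kappa>) powr p"
    "2 \<le> (1 - \<kappa>) powr p * ((1 + \<kappa>) powr p / 2) ^ j"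
    "(1 - a) powr p * (2 * 2 powr p) ^ j \<le> 1 / 2"
    using periodic_dip_parameters[OF p] .
  define c where "c = periodic_dip a j"
  have c: "\<bar>c n\<bar> \<le> a" for n
    using par by (simp add: c_def abs_periodic_dip)
  define lam where "lam = \<kappa> / a"
  have lam: "0 < lam" "lam < 1" using par by (auto simp: lam_def)
  define b where "b = symbol c"
  have "b \<in> BMO_d J"
    unfolding b_def using c by (rule symbol_BMO)
  moreover have "\<bar>haar_coeff J b I * haar I x\<bar> \<le> 1 - (1 - a)" if "I \<in> dyadic J" for I x
    unfolding b_def using haar_term_le[OF c that] by simp
  moreover have "invertible_Lp_o J p (\<lambda>f x. f x - paraproduct J b f x)"
    unfolding b_def
  proof (rule recursion_stable_imp_invertible[OF p c])
    show "recursion_stable p c"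
      unfolding c_def using p par by (intro periodic_dip_stable) auto
  qed
  moreover have "\<not> invertible_Lp_o J p (\<lambda>f x. f x - lam * paraproduct J b f x)"
    unfolding b_def
  proof (rule not_invertible[OF p c])
    have "(\<lambda>n. lam * c n) = periodic_dip \<kappa> j"
      using par by (auto simp: c_def lam_def periodic_dip_def)
    then show "\<not> wlp p (mean_recursion (\<lambda>n. lam * c n) (\<lambda>n. if n = 0 then 0 else 1))"
      using p par by (simp, intro periodic_dip_unstable) auto
  qed auto
  moreover have "0 < 1 - a" using par by simp
  ultimately show "\<exists>lam b eps. 0 < lam \<and> lam < 1 \<and> b \<in> BMO_d J \<and> 0 < eps \<and>
       (\<forall>I\<in>dyadic J. \<forall>x. \<bar>haar_coeff J b I * haar I x\<bar> \<le> 1 - eps) \<and>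
       invertible_Lp_o J p (\<lambda>f x. f x - paraproduct J b f x) \<and>
       \<not> invertible_Lp_o J p (\<lambda>f x. f x - lam * paraproduct J b f x)"
    using lam by blast
qed

end
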